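(* Let $n\ge1$, let $\mathcal U:\mathbb R_d^{2n}\to\mathbb R$ be smooth on each connected component of $\mathbb R_d^{2n}$, let $U_j=\partial_j\mathcal U$ for $j=1,\dots,2n$, and let $h_1,\dots,h_{2n}:\mathbb R\to\mathbb R$ be smooth functions such that the $U_j$ are solutions to $$\frac12U_j^2+\sum_{k\ne j}\frac{2}{x_k-x_j}U_k-\sum_{k\ne j}\frac{6}{(x_k-x_j)^2}=h_j(x_j),\qquad j=1,\dots,2n.$$ If the $U_j$, $j=1,\dots,2n$, generate curves that are each invariant under Möbius transformations, then $h_j\equiv0$ for $j=1,\dots,2n$.
   Context: $\mathbb R^{2n}_d\subset\mathbb R^{2n}$ is the open set of points with pairwise distinct coordinates; $\partial_j=\partial/\partial x_j$; $\mathbb H$ is the upper half-plane. The curve $\gamma_j$ generated by $U_j$ and initial data $\boldsymbol x=(x_1,\dots,x_{2n})\in\mathbb R_d^{2n}$ is the curve, growing from $x_j$, of the Loewner chain $$\partial_tg_{j,t}(z)=\frac{2}{g_{j,t}(z)-x_j(t)},\quad g_{j,0}(z)=z,\qquad \dot x_j=U_j(\boldsymbol x),\quad \dot x_k=\frac{2}{x_k-x_j}\ (k\ne j),\qquad \boldsymbol x(0)=\boldsymbol x .$$ Invariance of $\gamma_j$ under Möbius transformations means: if $\gamma_j$ is the curve generated by $U_j$ with initial data $\boldsymbol x$, and $\phi\in\mathrm{PSL}(2,\mathbb R)$ is a conformal automorphism of $\mathbb H$ (with all $\phi(x_i)$ finite, so that the new initial data lie in $\mathbb R_d^{2n}$),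 then $\phi(\gamma_j)$ is, at least up to a time change, the curve generated by $U_j$ with initial data $(\phi(x_1),\dots,\phi(x_{2n}))$. *)

theory Defs
  imports "HOL-Analysis.Analysis"
begin

definition distinct_points :: "(real ^ 'm) set" where
  "distinct_points = {x. \<forall>j k. j \<noteq> k \<longrightarrow> x $ j \<noteq> x $ k}"

primrec C_k_on :: "nat \<Rightarrow> ('a::real_normed_vector) set \<Rightarrow> ('a \<Rightarrow> real) \<Rightarrow> bool" where
  "C_k_on 0 S f \<longleftrightarrow> continuous_on S f"
| "C_k_on (Suc k) S f \<longleftrightarrow> (\<forall>x\<in>S. f differentiable (at x)) \<and>
     (\<forall>v. C_k_on k S (\<lambda>x. frechet_derivative f (at x) v))"

(* The derivatives are full ones (at x, not within S), so this is meant for open S. *)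
definition smooth_on :: "('a::real_normed_vector) set \<Rightarrow> ('a \<Rightarrow> real) \<Rightarrow> bool" where
  "smooth_on S f \<longleftrightarrow> (\<forall>k. C_k_on k S f)"

definition partial :: "'m \<Rightarrow> (real ^ 'm \<Rightarrow> real) \<Rightarrow> real ^ 'm \<Rightarrow> real" where
  "partial j f x = frechet_derivative f (at x) (axis j 1)"

(* Z is the solution up to and including time t, started from z, of the Loewner equation with
   driving function W. A starting point z in the upper half-plane has such a Z exactly when it
   is not swallowed by time t; Z then stays in the upper half-plane. *)
definition loewner_orbit ::
    "(real \<Rightarrow> real) \<Rightarrow> real \<Rightarrow> complex \<Rightarrow> (real \<Rightarrow> complex) \<Rightarrow> bool" where
  "loewner_orbit W t z Z \<longleftrightarrow> Z 0 = z \<and>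
     (\<forall>s\<in>{0..t}. Z s \<noteq> of_real (W s) \<and>
        (Z has_vector_derivative 2 / (Z s - of_real (W s))) (at s within {0..t}))"

(* The domain of the Loewner map at time t, i.e. the half-plane minus the hull. *)
definition loewner_dom :: "(real \<Rightarrow> real) \<Rightarrow> real \<Rightarrow> complex set" where
  "loewner_dom W t = {z. 0 < Im z \<and> (\<exists>Z. loewner_orbit W t z Z)}"

definition loewner_map :: "(real \<Rightarrow> real) \<Rightarrow> real \<Rightarrow> complex \<Rightarrow> complex" where
  "loewner_map W t z = (THE w. \<exists>Z. loewner_orbit W t z Z \<and> w = Z t)"

(* The trace of the chain up to time T: gamma(t) is the limit of the inverse Loewner map at
   W(t) + i y as y decreases to 0. This determines gamma on [0,T], with gamma(0) = W(0); for
   continuously differentiable W the limits exist and gamma is continuous. *)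
definition loewner_curve :: "(real \<Rightarrow> real) \<Rightarrow> real \<Rightarrow> (real \<Rightarrow> complex) \<Rightarrow> bool" where
  "loewner_curve W T \<gamma> \<longleftrightarrow>
     (\<forall>t\<in>{0..T}. ((\<lambda>y. inv_into (loewner_dom W t) (loewner_map W t) (Complex (W t) y))
        \<longlongrightarrow> \<gamma> t) (at_right 0))"

definition driving_solution ::
    "(real ^ 'm \<Rightarrow> real) \<Rightarrow> 'm \<Rightarrow> real ^ 'm \<Rightarrow> real \<Rightarrow> (real \<Rightarrow> real ^ 'm) \<Rightarrow> bool" where
  "driving_solution V j x0 T x \<longleftrightarrow> x 0 = x0 \<and>
     (\<forall>t\<in>{0..T}. x t \<in> distinct_points \<and>
        (x has_vector_derivative
           (\<chi> k. if k = j then V (x t) else 2 / (x t $ k - x t $ j))) (at t within {0..T}))"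

(* gamma restricted to [0,T] is the segment, up to time T, of the curve generated by V, growing
   from the j-th of the points x0. The whole curve is the union of its segments. *)
definition generated_curve ::
    "(real ^ 'm \<Rightarrow> real) \<Rightarrow> 'm \<Rightarrow> real ^ 'm \<Rightarrow> real \<Rightarrow> (real \<Rightarrow> complex) \<Rightarrow> bool" where
  "generated_curve V j x0 T \<gamma> \<longleftrightarrow>
     (\<exists>x. driving_solution V j x0 T x \<and> loewner_curve (\<lambda>t. x t $ j) T \<gamma>)"

definition time_change :: "real \<Rightarrow> real \<Rightarrow> (real \<Rightarrow> real) \<Rightarrow> bool" where
  "time_change T S \<sigma> \<longleftrightarrow>
     continuous_on {0..T} \<sigma> \<and> strict_mono_on {0..T} \<sigma> \<and> \<sigma> ` {0..T} = {0..S}"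

(* Invariance is required of every segment [0,T]. This is the same as invariance of the curves
   run for their whole lifetime: segments extend by uniqueness of the solutions, and applying
   the condition to the inverse transformation shows that lifetimes correspond. *)
definition moebius_invariant :: "(real ^ 'm \<Rightarrow> real) \<Rightarrow> 'm \<Rightarrow> bool" where
  "moebius_invariant V j \<longleftrightarrow>
     (\<forall>x0\<in>distinct_points. \<forall>T\<ge>0. \<forall>\<gamma>. \<forall>a b c d :: real.
        generated_curve V j x0 T \<gamma> \<and> a * d - b * c = 1 \<and> (\<forall>k. c * x0 $ k + d \<noteq> 0) \<longrightarrow>
        (\<exists>S \<sigma> \<gamma>'. time_change T S \<sigma> \<and>
           generated_curve V j (\<chi> k. moebius a b c d (x0 $ k)) S \<gamma>' \<and>
           (\<forall>t\<in>{0..T}. moebius (of_real a) (of_real b) (of_real c) (of_real d) (\<gamma> t) = \<gamma>' (\<sigma> t))))"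

end

theory Submission
  imports Defs
begin

text \<open>Invariance under the affine maps \<open>z \<mapsto> l z + b\<close> already suffices. If a trace \<open>\<gamma>\<close> has driving
  function \<open>W\<close>, then \<open>(Re (\<gamma> t) - W 0) / (Im (\<gamma> t))\<^sup>2\<close> tends to \<open>W' 0 / 6\<close> as \<open>t\<close> decreases to 0.
  This quotient is insensitive to time changes, and an affine map divides it by \<open>l\<close>; since
  \<open>W' 0 = U\<^sub>j x\<close>, invariance forces \<open>U\<^sub>j (l x + b) = U\<^sub>j x / l\<close>. Under \<open>x \<mapsto> 2 x - s\<close> the left-hand
  side of the PDE is then divided by 4, whereas \<open>h\<^sub>j (x\<^sub>j)\<close> does not change at \<open>x\<^sub>j = s\<close>, so \<open>h\<^sub>j s = 0\<close>.

  The expansion of the trace comes from the reverse flow \<open>\<zeta>' = w - 2 / \<zeta>\<close> started at \<open>\<i> y\<close>: its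
  square satisfies \<open>(\<zeta>\<^sup>2)' = 2 w \<zeta> - 4\<close>, in which the pole at \<open>\<zeta> = 0\<close> has disappeared.\<close>

subsection \<open>Ordinary differential equations\<close>

text \<open>The comparison principle behind the reverse flow estimates: each of them exhibits a
  function with nonnegative derivative and reads a bound off its end values. Derivatives are
  relative to the interval because solutions are only known to be differentiable within it.\<close>

lemma deriv_nonneg_imp_le_within:
  fixes f :: "real \<Rightarrow> real"
  assumes der: "\<And>r. r \<in> {a..b} \<Longrightarrow> (f has_real_derivative f' r) (at r within {a..b})"
    and nonneg: "\<And>r. r \<in> {a..b} \<Longrightarrow> 0 \<le> f' r"
    and st: "a \<le> s" "s \<le> t" "t \<le> b"
  shows "f s \<le> f t"
proof -
  have "\<exists>r\<in>{s..t}. f t - f s = f' r * (t - s)"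
  proof (rule mvt_very_simple[OF st(2), of f "\<lambda>r. (*) (f' r)"])
    fix r assume r: "s \<le> r" "r \<le> t"
    have "(f has_real_derivative f' r) (at r within {s..t})"
      by (rule has_field_derivative_subset[OF der]) (use r st in auto)
    then show "(f has_derivative (*) (f' r)) (at r within {s..t})"
      by (simp add: has_field_derivative_def)
  qed
  then obtain r where "r \<in> {s..t}" "f t - f s = f' r * (t - s)" by auto
  moreover have "0 \<le> f' r * (t - s)"
    using st nonneg \<open>r \<in> {s..t}\<close> by (intro mult_nonneg_nonneg) auto
  ultimately show ?thesis by linarith
qed

text \<open>Banach's fixed point theorem for the rescaled unknown
  \<open>u t = exp (- K * t) x t\<close>. The exponential weight makes the Picard operator a
  contraction on the whole interval at once, whatever its length, so no local solutions have to be
  glued.\<close>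

lemma picard_lindelof_global:
  fixes F :: "real \<Rightarrow> 'a::banach \<Rightarrow> 'a"
  assumes "0 \<le> T" "0 \<le> L"
    and cont: "\<And>u. continuous_on {0..T} u \<Longrightarrow> continuous_on {0..T} (\<lambda>t. F t (u t))"
    and lip: "\<And>t x y. t \<in> {0..T} \<Longrightarrow> norm (F t x - F t y) \<le> L * norm (x - y)"
  obtains x where "x 0 = x0"
    "\<And>t. t \<in> {0..T} \<Longrightarrow> (x has_vector_derivative F t (x t)) (at t within {0..T})"
proof -
  \<comment> \<open>Any \<open>K > L\<close> would do: the contraction factor is
    \<open>L / K\<close>.\<close>
  define K where "K = L + 1"
  have K: "0 < K" using assms by (simp add: K_def)
  define J where "J u t = integral {0..t} (\<lambda>s. F s (exp (K * s) *\<^sub>R u s))" for u :: "real \<Rightarrow> 'a" and t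
  have contF: "continuous_on {0..T} (\<lambda>s. F s (exp (K * s) *\<^sub>R apply_bcontfun u s))" for u
    by (rule cont) (auto intro!: continuous_intros)
  have J_deriv: "(J u has_vector_derivative F t (exp (K * t) *\<^sub>R u t)) (at t within {0..T})"
    if "t \<in> {0..T}" for u :: "real \<Rightarrow>\<^sub>C 'a" and t
    unfolding J_def by (rule integral_has_vector_derivative[OF contF that])
  have J_cont: "continuous_on {0..T} (J u)" for u :: "real \<Rightarrow>\<^sub>C 'a"
    by (rule continuous_on_vector_derivative) (rule J_deriv)
  \<comment> \<open>The complete space is that of bounded continuous functions on the whole line;
    clamping the time argument extends the Picard iterate constantly outside
    \<open>{0..T}\<close>.\<close>
  have "\<exists>v :: real \<Rightarrow>\<^sub>C 'a. \<forall>t. v t = exp (- K * clamp 0 T t) *\<^sub>R (x0 + J u (clamp 0 T t))"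
    for u :: "real \<Rightarrow>\<^sub>C 'a"
  proof -
    have "continuous_on (cbox 0 T) (\<lambda>t. exp (- K * t) *\<^sub>R (x0 + J u t))"
      unfolding cbox_interval by (intro continuous_intros J_cont)
    then show ?thesis by (rule continuous_on_cbox_bcontfunE) metis
  qed
  then obtain P :: "(real \<Rightarrow>\<^sub>C 'a) \<Rightarrow> real \<Rightarrow>\<^sub>C 'a"
    where P: "\<And>u t. P u t = exp (- K * clamp 0 T t) *\<^sub>R (x0 + J u (clamp 0 T t))"
    by metis
  have clamp: "clamp 0 T t \<in> {0..T}" for t
    using clamp_in_interval[of 0 T t] \<open>0 \<le> T\<close> by (simp add: cbox_interval)
  have contraction: "dist (P u) (P v) \<le> L / K * dist u v" for u v
  proof (rule dist_bound)
    fix t0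
    define t where "t = clamp 0 T t0"
    have t: "0 \<le> t" "t \<le> T" using clamp[of t0] by (auto simp: t_def)
    define d where "d = dist u v"
    have d: "norm (u s - v s) \<le> d" for s
      using dist_bounded[of u s v] by (simp add: d_def dist_norm)
    have int: "(\<lambda>s. F s (exp (K * s) *\<^sub>R apply_bcontfun u s)) integrable_on {0..t}" for u
      by (rule integrable_continuous_real[OF continuous_on_subset[OF contF]]) (use t in auto)
    have hi: "((\<lambda>s. L * d * exp (K * s)) has_integral L * d / K * exp (K * t) - L * d / K * exp (K * 0)) {0..t}"
      using t K
      by (intro fundamental_theorem_of_calculus)
        (auto intro!: derivative_eq_intros simp: has_real_derivative_iff_has_vector_derivative[symmetric])
    have "norm (J u t - J v t) \<le> integral {0..t} (\<lambda>s. L * d * exp (K * s))"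
      unfolding J_def integral_diff[OF int int, symmetric]
    proof (rule integral_norm_bound_integral)
      show "(\<lambda>s. L * d * exp (K * s)) integrable_on {0..t}" using hi by blast
      fix s assume s: "s \<in> {0..t}"
      have "norm (F s (exp (K * s) *\<^sub>R u s) - F s (exp (K * s) *\<^sub>R v s))
          \<le> L * norm (exp (K * s) *\<^sub>R u s - exp (K * s) *\<^sub>R v s)"
        by (rule lip) (use s t in auto)
      also have "\<dots> = L * (exp (K * s) * norm (u s - v s))"
        by (simp add: scaleR_diff_right[symmetric])
      also have "\<dots> \<le> L * (exp (K * s) * d)"
        by (intro mult_left_mono d \<open>0 \<le> L\<close>) auto
      finally show "norm (F s (exp (K * s) *\<^sub>R u s) - F s (exp (K * s) *\<^sub>R v s)) \<le> L * d * exp (K * s)"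
        by (simp add: mult_ac)
    qed (intro integrable_diff int)
    also have "\<dots> = L * d / K * (exp (K * t) - 1)"
      using integral_unique[OF hi] by (simp add: algebra_simps)
    finally have J: "norm (J u t - J v t) \<le> L * d / K * (exp (K * t) - 1)" .
    have "dist (P u t0) (P v t0) = exp (- K * t) * norm (J u t - J v t)"
      by (simp add: P t_def[symmetric] dist_norm scaleR_diff_right[symmetric])
    also have "\<dots> \<le> exp (- K * t) * (L * d / K * (exp (K * t) - 1))"
      by (intro mult_left_mono J) auto
    also have "\<dots> = L * d / K * (1 - exp (- K * t))"
      by (simp add: exp_minus field_simps)
    also have "\<dots> \<le> L * d / K * 1"
      using \<open>0 \<le> L\<close> K by (intro mult_left_mono) (auto simp: d_def)
    finally show "dist (P u t0) (P v t0) \<le> L / K * dist u v" by (simp add: d_def)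
  qed
  have "\<exists>!u. P u = u"
    by (rule banach_fix_type[of "L / K"]) (use contraction \<open>0 \<le> L\<close> K in \<open>auto simp: K_def\<close>)
  then obtain u where u: "P u = u" by blast
  have u_eq: "exp (K * t) *\<^sub>R u t = x0 + J u t" if "t \<in> {0..T}" for t
  proof -
    have "clamp 0 T t = t" using that by (intro clamp_cancel_cbox) (auto simp: cbox_interval)
    then have "u t = exp (- K * t) *\<^sub>R (x0 + J u t)" using P[of u t] u by simp
    then show ?thesis by (simp add: exp_minus)
  qed
  show thesis
  proof (rule that[of "\<lambda>t. x0 + J u t"])
    show "x0 + J u 0 = x0" by (simp add: J_def)
    show "((\<lambda>t. x0 + J u t) has_vector_derivative F t (x0 + J u t)) (at t within {0..T})"
      if "t \<in> {0..T}" for t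
      using has_vector_derivative_add[OF has_vector_derivative_const J_deriv[OF that, of u]]
      by (simp add: u_eq[OF that])
  qed
qed

text \<open>The integrating factor \<open>exp (- A s)\<close> turns \<open>D\<close> into a
  constant. The zero may sit at any time \<open>t0\<close>, so uniqueness follows both forwards and
  backwards in time.\<close>

lemma linear_ode_eq_0:
  fixes D a :: "real \<Rightarrow> complex"
  assumes a: "continuous_on {0..T} a"
    and D: "\<And>s. s \<in> {0..T} \<Longrightarrow> (D has_vector_derivative a s * D s) (at s within {0..T})"
    and t0: "t0 \<in> {0..T}" "D t0 = 0" and s: "s \<in> {0..T}"
  shows "D s = 0"
proof -
  define A where "A s = integral {0..s} a" for s
  define E where "E s = exp (- A s) * D s" for s
  have A: "(A has_vector_derivative a s) (at s within {0..T})" if "s \<in> {0..T}" for s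
    unfolding A_def using integral_has_vector_derivative[OF a that] by simp
  have "(E has_vector_derivative 0) (at s within {0..T})" if "s \<in> {0..T}" for s
  proof -
    have "(((\<lambda>z. exp (- z)) \<circ> A) has_vector_derivative a s * (- exp (- A s))) (at s within {0..T})"
      by (rule field_vector_diff_chain_within[OF A[OF that]]) (auto intro!: derivative_eq_intros)
    then have "((\<lambda>s. exp (- A s)) has_vector_derivative - (a s * exp (- A s))) (at s within {0..T})"
      by (simp add: o_def)
    from has_vector_derivative_mult[OF this D[OF that]] show ?thesis
      unfolding E_def by (simp add: algebra_simps)
  qed
  then have "E s = E t0"
    using has_vector_derivative_zero_constant[of "{0..T}" E] s t0 by (metis convex_real_interval(5))
  then show ?thesis using t0 by (simp add: E_def)
qed

text \<open>On the compact ball the derivative is bounded along each basis vector; the sum of these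
  bounds controls its operator norm, and the mean value inequality applies because the ball is
  convex.\<close>

lemma C_k_on_1_lipschitz_cball:
  fixes f :: "'a::euclidean_space \<Rightarrow> real"
  assumes f: "C_k_on 1 C f" and sub: "cball x0 r \<subseteq> C"
  shows "\<exists>L\<ge>0. \<forall>x\<in>cball x0 r. \<forall>y\<in>cball x0 r. \<bar>f x - f y\<bar> \<le> L * norm (x - y)"
proof -
  define f' where "f' x = frechet_derivative f (at x)" for x
  have der: "(f has_derivative f' x) (at x)" if "x \<in> C" for x
    using f that by (simp add: f'_def frechet_derivative_works[symmetric])
  have "\<exists>B. \<forall>x\<in>cball x0 r. \<bar>f' x b\<bar> \<le> B" for b
  proof -
    have "continuous_on (cball x0 r) (\<lambda>x. f' x b)"
      using f sub unfolding f'_def by (auto intro: continuous_on_subset)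
    then have "bounded ((\<lambda>x. f' x b) ` cball x0 r)"
      by (intro compact_imp_bounded compact_continuous_image) auto
    then show ?thesis by (auto simp: bounded_iff)
  qed
  then obtain B where B: "\<And>b x. x \<in> cball x0 r \<Longrightarrow> \<bar>f' x b\<bar> \<le> B b" by metis
  \<comment> \<open>The maximum with 0 keeps the constant nonnegative also for an empty ball, where
    the numbers \<open>B b\<close> are arbitrary.\<close>
  have "\<bar>f x - f y\<bar> \<le> max 0 (\<Sum>b\<in>Basis. B b) * norm (x - y)"
    if "x \<in> cball x0 r" "y \<in> cball x0 r" for x y
    unfolding real_norm_def[symmetric]
  proof (rule differentiable_bound[OF convex_cball[of x0 r] _ _ that])
    fix z assume z: "z \<in> cball x0 r"
    then have der_z: "(f has_derivative f' z) (at z)" using sub der by auto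
    then show "(f has_derivative f' z) (at z within cball x0 r)" by (rule has_derivative_at_withinI)
    have lin: "linear (f' z)" using der_z by (rule has_derivative_linear)
    show "onorm (f' z) \<le> max 0 (\<Sum>b\<in>Basis. B b)"
    proof (rule onorm_bound)
      fix v
      have "f' z v = (\<Sum>b\<in>Basis. (v \<bullet> b) * f' z b)"
        by (subst euclidean_representation[of v, symmetric])
          (simp add: linear_sum[OF lin] linear_cmul[OF lin])
      also have "\<bar>\<dots>\<bar> \<le> (\<Sum>b\<in>Basis. norm v * B b)"
        unfolding abs_mult
        by (intro order_trans[OF sum_abs] sum_mono)
          (auto simp: abs_mult intro!: mult_mono Basis_le_norm B z)
      also have "\<dots> \<le> max 0 (\<Sum>b\<in>Basis. B b) * norm v"
        unfolding sum_distrib_left[symmetric] by (simp add: mult.commute mult_left_mono)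
      finally show "norm (f' z v) \<le> max 0 (\<Sum>b\<in>Basis. B b) * norm v" by simp
    qed simp
  qed
  then show ?thesis by (intro exI[of _ "max 0 (\<Sum>b\<in>Basis. B b)"]) auto
qed

text \<open>Precomposing \<open>G\<close> with the nearest-point projection onto the ball gives a
  globally Lipschitz field. Its solution stays in the ball for a short time, and there the
  projection is the identity.\<close>

lemma ode_local_solution:
  fixes G :: "'a::euclidean_space \<Rightarrow> 'a"
  assumes r: "0 < r" and L: "0 \<le> L"
    and lip: "\<And>x y. x \<in> cball x0 r \<Longrightarrow> y \<in> cball x0 r \<Longrightarrow> norm (G x - G y) \<le> L * norm (x - y)"
  obtains T x where "0 < T" "x 0 = x0" "\<And>t. t \<in> {0..T} \<Longrightarrow> x t \<in> cball x0 r"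
    "\<And>t. t \<in> {0..T} \<Longrightarrow> (x has_vector_derivative G (x t)) (at t within {0..T})"
proof -
  define p where "p = closest_point (cball x0 r)"
  have ball: "convex (cball x0 r)" "closed (cball x0 r)" "cball x0 r \<noteq> {}" using r by auto
  have p: "p y \<in> cball x0 r" for y
    unfolding p_def using ball by (intro closest_point_in_set) auto
  have p_lip: "norm (p y - p z) \<le> norm (y - z)" for y z
    using closest_point_lipschitz[OF ball] by (simp add: p_def dist_norm)
  have Gp_lip: "norm (G (p y) - G (p z)) \<le> L * norm (y - z)" for y z
    using lip[OF p p, of y z] mult_left_mono[OF p_lip L, of y z] by linarith
  have "L-lipschitz_on UNIV (\<lambda>y. G (p y))"
    using L Gp_lip by (simp add: lipschitz_on_def dist_norm)
  then have Gp_cont: "continuous_on UNIV (\<lambda>y. G (p y))" by (rule lipschitz_on_continuous_on)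
  obtain x where x: "x 0 = x0"
    "\<And>t. t \<in> {0..1} \<Longrightarrow> (x has_vector_derivative G (p (x t))) (at t within {0..1})"
    by (rule picard_lindelof_global[of 1 L "\<lambda>t y. G (p y)" x0])
      (use L Gp_lip in \<open>auto intro: continuous_on_compose2[OF Gp_cont]\<close>)
  have "continuous_on {0..1} x" by (rule continuous_on_vector_derivative) (rule x)
  then obtain d where d: "0 < d" "\<And>t. t \<in> {0..1} \<Longrightarrow> dist t 0 < d \<Longrightarrow> dist (x t) (x 0) < r"
    unfolding continuous_on_iff using r by (metis atLeastAtMost_iff order_refl zero_le_one)
  show thesis
  proof (rule that[of "min 1 (d / 2)" x])
    show in_ball: "x t \<in> cball x0 r" if "t \<in> {0..min 1 (d / 2)}" for t
      using d that x(1) by (auto simp: dist_commute less_imp_le)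
    show "(x has_vector_derivative G (x t)) (at t within {0..min 1 (d / 2)})"
      if "t \<in> {0..min 1 (d / 2)}" for t
    proof -
      have "p (x t) = x t" unfolding p_def using in_ball[OF that] by (rule closest_point_self)
      then show ?thesis
        using x(2)[of t] that by (auto intro: has_vector_derivative_within_subset)
    qed
  qed (use d x in auto)
qed

subsection \<open>Loewner orbits and their time reversal\<close>

lemma has_vector_derivative_time_reversal:
  assumes "(f has_vector_derivative d) (at (t - s) within {0..t})"
  shows "((\<lambda>s. f (t - s)) has_vector_derivative - d) (at s within {0..t})"
proof -
  have "(\<lambda>s. t - s) ` {0..t} = {0..t}" by simp
  then have "((f \<circ> (\<lambda>s. t - s)) has_vector_derivative (-1) *\<^sub>R d) (at s within {0..t})"
    by (intro vector_diff_chain_within) (auto intro!: derivative_eq_intros assms)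
  then show ?thesis by (simp add: o_def)
qed

lemma loewner_orbit_continuous:
  "loewner_orbit W t z Z \<Longrightarrow> continuous_on {0..t} Z"
  by (rule continuous_on_vector_derivative) (auto simp: loewner_orbit_def)

text \<open>The difference of two orbits solves a linear equation with continuous coefficient.
  Agreement at time 0 makes the Loewner map well defined; agreement at the terminal time makes it
  injective.\<close>

lemma loewner_orbit_unique:
  assumes W: "continuous_on {0..t} W"
    and Z: "loewner_orbit W t z Z" "loewner_orbit W t z' Z'"
    and t0: "t0 \<in> {0..t}" "Z t0 = Z' t0" and s: "s \<in> {0..t}"
  shows "Z s = Z' s"
proof -
  define a where "a s = - 2 / ((Z s - of_real (W s)) * (Z' s - of_real (W s)))" for s
  have ne: "Z s \<noteq> of_real (W s)" "Z' s \<noteq> of_real (W s)" if "s \<in> {0..t}" for s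
    using Z that by (auto simp: loewner_orbit_def)
  have *: "2 / p - 2 / q = - 2 / (p * q) * (p - q)" if "p \<noteq> 0" "q \<noteq> 0" for p q :: complex
    using that by (simp add: divide_simps)
  have "Z s - Z' s = 0"
  proof (rule linear_ode_eq_0[of t a "\<lambda>s. Z s - Z' s"])
    show "continuous_on {0..t} a"
      unfolding a_def using ne
      by (intro continuous_intros loewner_orbit_continuous[OF Z(1)] loewner_orbit_continuous[OF Z(2)] W) auto
    show "((\<lambda>s. Z s - Z' s) has_vector_derivative a s * (Z s - Z' s)) (at s within {0..t})"
      if "s \<in> {0..t}" for s
    proof -
      have "((\<lambda>s. Z s - Z' s) has_vector_derivative
          2 / (Z s - of_real (W s)) - 2 / (Z' s - of_real (W s))) (at s within {0..t})"
        using Z that by (intro has_vector_derivative_diff) (auto simp: loewner_orbit_def)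
      also have "2 / (Z s - of_real (W s)) - 2 / (Z' s - of_real (W s)) = a s * (Z s - Z' s)"
        using * ne[OF that] by (simp add: a_def)
      finally show ?thesis .
    qed
  qed (use t0 s in auto)
  then show ?thesis by simp
qed

lemma loewner_map_eq:
  assumes "continuous_on {0..t} W" "0 \<le> t" "loewner_orbit W t z Z"
  shows "loewner_map W t z = Z t"
  unfolding loewner_map_def
proof (rule the_equality)
  show "\<exists>Z'. loewner_orbit W t z Z' \<and> Z t = Z' t" using assms by blast
  show "w = Z t" if ex: "\<exists>Z'. loewner_orbit W t z Z' \<and> w = Z' t" for w
  proof -
    obtain Z' where "loewner_orbit W t z Z'" "w = Z' t" using ex by blast
    moreover have "Z' 0 = Z 0" using assms(3) calculation by (simp add: loewner_orbit_def)
    ultimately show ?thesis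
      using loewner_orbit_unique[OF assms(1) _ assms(3), of z Z' 0 t] assms(2) by simp
  qed
qed

text \<open>Reduces the inverse Loewner map to an orbit with prescribed end point: injectivity comes
  from uniqueness of orbits backwards in time.\<close>

lemma inv_loewner_map_eq:
  assumes W: "continuous_on {0..t} W" and t: "0 \<le> t"
    and Z: "loewner_orbit W t (Z 0) Z" "0 < Im (Z 0)"
  shows "inv_into (loewner_dom W t) (loewner_map W t) (Z t) = Z 0"
proof -
  have "inj_on (loewner_map W t) (loewner_dom W t)"
  proof (rule inj_onI)
    fix z1 z2
    assume "z1 \<in> loewner_dom W t" "z2 \<in> loewner_dom W t"
      and eq: "loewner_map W t z1 = loewner_map W t z2"
    then obtain Z1 Z2 where o: "loewner_orbit W t z1 Z1" "loewner_orbit W t z2 Z2"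
      by (auto simp: loewner_dom_def)
    have "Z1 t = Z2 t" using eq o by (simp add: loewner_map_eq[OF W t])
    then have "Z1 0 = Z2 0"
      using loewner_orbit_unique[OF W o, of t 0] t by simp
    then show "z1 = z2" using o by (simp add: loewner_orbit_def)
  qed
  moreover have "Z 0 \<in> loewner_dom W t" using Z by (auto simp: loewner_dom_def)
  moreover have "loewner_map W t (Z 0) = Z t" by (rule loewner_map_eq[OF W t Z(1)])
  ultimately show ?thesis by (metis inv_into_f_f)
qed

text \<open>Clipping the imaginary part at its terminal value makes the vector field globally Lipschitz;
  since the imaginary part only grows backwards in time, the clipping has no effect on the solution.\<close>

lemma loewner_orbit_ending_at:
  assumes W: "continuous_on {0..t} W" and t: "0 \<le> t" and w: "0 < Im w"
  obtains Z where "loewner_orbit W t (Z 0) Z" "Z t = w" "\<And>s. s \<in> {0..t} \<Longrightarrow> Im w \<le> Im (Z s)"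
proof -
  define y where "y = Im w"
  define clip :: "complex \<Rightarrow> complex" where "clip x = of_real (Re x) + \<i> * of_real (max (Im x) y)" for x
  have y: "0 < y" using w by (simp add: y_def)
  have Im_clip: "y \<le> Im (clip x)" for x by (simp add: clip_def)
  have norm_clip: "y \<le> norm (clip x)" for x
    using Im_clip[of x] abs_Im_le_cmod[of "clip x"] by linarith
  have clip_nz: "clip x \<noteq> 0" for x using norm_clip[of x] y by auto
  have clip_lip: "norm (clip x - clip x') \<le> norm (x - x')" for x x'
    unfolding cmod_def by (rule real_sqrt_le_mono) (auto simp: clip_def abs_le_square_iff[symmetric] intro!: add_mono)
  have clip_cont: "continuous_on S (\<lambda>r. clip (g r))" if "continuous_on S g" for S :: "real set" and g
    unfolding clip_def by (intro continuous_intros that)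
  \<comment> \<open>The Loewner field with \<open>r\<close> running backwards from \<open>t\<close>,
    hence the minus sign and \<open>W (t - r)\<close>. After clipping, denominators have modulus at
    least \<open>y\<close>, which yields the Lipschitz constant
    \<open>2 / y\<^sup>2\<close>.\<close>
  define F where "F r x = - 2 / clip (x - of_real (W (t - r)))" for r x
  obtain X where X: "X 0 = w"
    "\<And>r. r \<in> {0..t} \<Longrightarrow> (X has_vector_derivative F r (X r)) (at r within {0..t})"
  proof (rule picard_lindelof_global[OF t, of "2 / y\<^sup>2" F w])
    show "0 \<le> 2 / y\<^sup>2" by simp
    have W': "continuous_on {0..t} (\<lambda>r. W (t - r))"
      by (rule continuous_on_compose2[OF W]) (auto intro!: continuous_intros)
    show "continuous_on {0..t} (\<lambda>r. F r (u r))" if "continuous_on {0..t} u" for u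
      unfolding F_def by (intro continuous_intros clip_cont that W' ballI clip_nz)
    fix r x x'
    let ?a = "clip (x - of_real (W (t - r)))" and ?b = "clip (x' - of_real (W (t - r)))"
    have "norm (F r x - F r x') = 2 * norm (?a - ?b) / (norm ?a * norm ?b)"
    proof -
      have "F r x - F r x' = 2 * (?a - ?b) / (?a * ?b)"
        using clip_nz by (simp add: F_def field_simps)
      then show ?thesis by (simp only: norm_mult norm_divide norm_numeral)
    qed
    also have "\<dots> \<le> 2 * norm (x - x') / (y * y)"
      using clip_lip[of "x - of_real (W (t - r))" "x' - of_real (W (t - r))"] norm_clip y
      by (intro frac_le mult_mono) auto
    finally show "norm (F r x - F r x') \<le> 2 / y\<^sup>2 * norm (x - x')"
      by (simp add: power2_eq_square)
  qed blast
  have Im_X: "y \<le> Im (X r)" if "r \<in> {0..t}" for r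
  proof -
    have "Im (X 0) \<le> Im (X r)"
    proof (rule deriv_nonneg_imp_le_within[of 0 t "\<lambda>r. Im (X r)" "\<lambda>r. Im (F r (X r))"])
      show "((\<lambda>r. Im (X r)) has_real_derivative Im (F r (X r))) (at r within {0..t})"
        if "r \<in> {0..t}" for r
        unfolding has_real_derivative_iff_has_vector_derivative
        by (rule bounded_linear.has_vector_derivative[OF bounded_linear_Im X(2)[OF that]])
      show "0 \<le> Im (F r (X r))" for r
        using Im_clip[of "X r - of_real (W (t - r))"] y
        by (simp add: F_def Im_divide)
    qed (use that in auto)
    then show ?thesis by (simp add: X y_def)
  qed
  have ne: "X r \<noteq> of_real c" if "r \<in> {0..t}" for r c
    using Im_X[OF that] y by auto
  have F_eq: "F r (X r) = - 2 / (X r - of_real (W (t - r)))" if "r \<in> {0..t}" for r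
  proof -
    have "clip (X r - of_real (W (t - r))) = X r - of_real (W (t - r))"
      using Im_X[OF that] by (simp add: clip_def complex_eq_iff max_def)
    then show ?thesis by (simp add: F_def)
  qed
  show thesis
  proof (rule that[of "\<lambda>s. X (t - s)"])
    show "loewner_orbit W t (X (t - 0)) (\<lambda>s. X (t - s))"
      unfolding loewner_orbit_def
    proof (intro conjI ballI)
      fix s assume s: "s \<in> {0..t}"
      then have s': "t - s \<in> {0..t}" by auto
      show "X (t - s) \<noteq> of_real (W s)" using ne[OF s'] .
      show "((\<lambda>s. X (t - s)) has_vector_derivative 2 / (X (t - s) - of_real (W s))) (at s within {0..t})"
        using has_vector_derivative_time_reversal[OF X(2)[OF s']] F_eq[OF s'] by simp
    qed simp
  qed (use X Im_X in \<open>auto simp: y_def\<close>)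
qed

text \<open>A Loewner orbit seen from the driving point and run backwards:
  \<open>\<zeta> r = Z (t - r) - W (t - r)\<close> with \<open>w r = W' (t - r)\<close>. The bound
  on \<open>Im\<close> keeps \<open>\<zeta>\<close> away from the pole.\<close>

definition reverse_flow :: "(real \<Rightarrow> real) \<Rightarrow> real \<Rightarrow> real \<Rightarrow> (real \<Rightarrow> complex) \<Rightarrow> bool" where
  "reverse_flow w t y \<zeta> \<longleftrightarrow> \<zeta> 0 = Complex 0 y \<and>
     (\<forall>r\<in>{0..t}. y \<le> Im (\<zeta> r) \<and>
        (\<zeta> has_vector_derivative of_real (w r) - 2 / \<zeta> r) (at r within {0..t}))"

text \<open>The bridge to the trace: the expression whose limit as \<open>y\<close> decreases to 0
  defines the trace becomes the end point of a reverse flow.\<close>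

lemma inv_loewner_map_reverse_flow:
  assumes W: "\<And>s. s \<in> {0..t} \<Longrightarrow> (W has_vector_derivative W' s) (at s within {0..t})"
    and t: "0 \<le> t" and y: "0 < y"
  obtains \<zeta> where "reverse_flow (\<lambda>r. W' (t - r)) t y \<zeta>"
    "inv_into (loewner_dom W t) (loewner_map W t) (Complex (W t) y) = of_real (W 0) + \<zeta> t"
proof -
  have Wc: "continuous_on {0..t} W" by (rule continuous_on_vector_derivative) (rule W)
  obtain Z where Z: "loewner_orbit W t (Z 0) Z" "Z t = Complex (W t) y"
      "\<And>s. s \<in> {0..t} \<Longrightarrow> y \<le> Im (Z s)"
    by (rule loewner_orbit_ending_at[OF Wc t, of "Complex (W t) y"]) (use y in auto)
  show thesis
  proof (rule that[of "\<lambda>r. Z (t - r) - of_real (W (t - r))"])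
    show "inv_into (loewner_dom W t) (loewner_map W t) (Complex (W t) y)
        = of_real (W 0) + (Z (t - t) - of_real (W (t - t)))"
      using inv_loewner_map_eq[OF Wc t Z(1)] Z(2) Z(3)[of 0] y t by simp
    show "reverse_flow (\<lambda>r. W' (t - r)) t y (\<lambda>r. Z (t - r) - of_real (W (t - r)))"
      unfolding reverse_flow_def
    proof (intro conjI ballI)
      show "Z (t - 0) - of_real (W (t - 0)) = Complex 0 y"
        by (simp add: Z complex_eq_iff)
      fix r assume r: "r \<in> {0..t}"
      then have r': "t - r \<in> {0..t}" by auto
      show "y \<le> Im (Z (t - r) - of_real (W (t - r)))" using Z(3)[OF r'] by simp
      have "((\<lambda>s. Z s - of_real (W s)) has_vector_derivative
          2 / (Z (t - r) - of_real (W (t - r))) - of_real (W' (t - r))) (at (t - r) within {0..t})"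
        using Z(1) r' W[OF r']
        by (intro has_vector_derivative_diff has_vector_derivative_of_real)
          (auto simp: loewner_orbit_def has_real_derivative_iff_has_vector_derivative)
      from has_vector_derivative_time_reversal[OF this]
      show "((\<lambda>r. Z (t - r) - of_real (W (t - r))) has_vector_derivative
          of_real (W' (t - r)) - 2 / (Z (t - r) - of_real (W (t - r)))) (at r within {0..t})"
        by simp
    qed
  qed
qed

subsection \<open>Estimates for the reverse flow\<close>

lemma reverse_flow_Re_deriv:
  assumes "reverse_flow w t y \<zeta>" "r \<in> {0..t}"
  shows "((\<lambda>r. Re (\<zeta> r)) has_real_derivative w r - 2 * Re (\<zeta> r) / (norm (\<zeta> r))\<^sup>2) (at r within {0..t})"
  using bounded_linear.has_vector_derivative[OF bounded_linear_Re, of \<zeta> "of_real (w r) - 2 / \<zeta> r"] assms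
  by (simp add: reverse_flow_def has_real_derivative_iff_has_vector_derivative Re_divide cmod_power2)

lemma reverse_flow_Im_deriv:
  assumes "reverse_flow w t y \<zeta>" "r \<in> {0..t}"
  shows "((\<lambda>r. Im (\<zeta> r)) has_real_derivative 2 * Im (\<zeta> r) / (norm (\<zeta> r))\<^sup>2) (at r within {0..t})"
  using bounded_linear.has_vector_derivative[OF bounded_linear_Im, of \<zeta> "of_real (w r) - 2 / \<zeta> r"] assms
  by (simp add: reverse_flow_def has_real_derivative_iff_has_vector_derivative Im_divide cmod_power2)

lemma reverse_flow_Im_ge: "reverse_flow w t y \<zeta> \<Longrightarrow> r \<in> {0..t} \<Longrightarrow> y \<le> Im (\<zeta> r)"
  by (simp add: reverse_flow_def)

lemma reverse_flow_square_deriv: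
  assumes "reverse_flow w t y \<zeta>" "0 < y" "r \<in> {0..t}"
  shows "((\<lambda>r. (\<zeta> r)\<^sup>2) has_vector_derivative 2 * of_real (w r) * \<zeta> r - 4) (at r within {0..t})"
proof -
  have "\<zeta> r \<noteq> 0" using reverse_flow_Im_ge[OF assms(1,3)] assms(2) by auto
  moreover have "(\<zeta> has_vector_derivative of_real (w r) - 2 / \<zeta> r) (at r within {0..t})"
    using assms by (simp add: reverse_flow_def)
  from has_vector_derivative_mult[OF this this]
  have "((\<lambda>r. (\<zeta> r)\<^sup>2) has_vector_derivative
      \<zeta> r * (of_real (w r) - 2 / \<zeta> r) + (of_real (w r) - 2 / \<zeta> r) * \<zeta> r) (at r within {0..t})"
    by (simp add: power2_eq_square)
  ultimately show ?thesis by (simp add: algebra_simps)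
qed

text \<open>The term \<open>- 2 / \<zeta>\<close> always pulls the real part towards 0, so only the
  drift \<open>w\<close> can push it away, at speed at most \<open>M\<close>.\<close>

lemma reverse_flow_Re_bound:
  assumes rf: "reverse_flow w t y \<zeta>" and y: "0 < y"
    and w: "\<And>r. r \<in> {0..t} \<Longrightarrow> \<bar>w r\<bar> \<le> M" and r: "r \<in> {0..t}"
  shows "\<bar>Re (\<zeta> r)\<bar> \<le> M * r"
proof (rule field_le_epsilon)
  fix e :: real assume e: "0 < e"
  \<comment> \<open>The square root is a differentiable substitute for the absolute value of
    \<open>Re (\<zeta> s)\<close>; it costs an error of at most \<open>e\<close>.\<close>
  define f where "f s = M * s - sqrt ((Re (\<zeta> s))\<^sup>2 + e\<^sup>2)" for s
  have "f 0 \<le> f r"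
  proof (rule deriv_nonneg_imp_le_within[of 0 t f
      "\<lambda>s. M - Re (\<zeta> s) * (w s - 2 * Re (\<zeta> s) / (norm (\<zeta> s))\<^sup>2) / sqrt ((Re (\<zeta> s))\<^sup>2 + e\<^sup>2)"])
    fix s assume s: "s \<in> {0..t}"
    let ?q = "sqrt ((Re (\<zeta> s))\<^sup>2 + e\<^sup>2)"
    have pos: "0 < (Re (\<zeta> s))\<^sup>2 + e\<^sup>2" using e by (simp add: sum_power2_gt_zero_iff)
    show "(f has_real_derivative M - Re (\<zeta> s) * (w s - 2 * Re (\<zeta> s) / (norm (\<zeta> s))\<^sup>2) / ?q) (at s within {0..t})"
    proof -
      have "((\<lambda>s. M * s - sqrt ((g s)\<^sup>2 + e\<^sup>2)) has_real_derivative M - g s * d / sqrt ((g s)\<^sup>2 + e\<^sup>2)) (at s within A)"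
        if "(g has_real_derivative d) (at s within A)" "0 < (g s)\<^sup>2 + e\<^sup>2" for g d A
        using that(2) by (auto intro!: derivative_eq_intros that(1) simp: field_simps)
      from this[OF reverse_flow_Re_deriv[OF rf s] pos] show ?thesis unfolding f_def .
    qed
    have "Re (\<zeta> s) * (w s - 2 * Re (\<zeta> s) / (norm (\<zeta> s))\<^sup>2)
        = Re (\<zeta> s) * w s - 2 * (Re (\<zeta> s))\<^sup>2 / (norm (\<zeta> s))\<^sup>2"
      by (simp add: algebra_simps power2_eq_square)
    also have "\<dots> \<le> Re (\<zeta> s) * w s" by simp
    also have "\<dots> \<le> \<bar>Re (\<zeta> s)\<bar> * \<bar>w s\<bar>" by (simp add: abs_mult[symmetric])
    also have "\<dots> \<le> ?q * M"
      using w[OF s] by (intro mult_mono) auto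
    finally show "0 \<le> M - Re (\<zeta> s) * (w s - 2 * Re (\<zeta> s) / (norm (\<zeta> s))\<^sup>2) / ?q"
      using pos by (simp add: field_simps)
  qed (use r in auto)
  then have "sqrt ((Re (\<zeta> r))\<^sup>2 + e\<^sup>2) \<le> M * r + e"
    using rf e by (simp add: f_def reverse_flow_def)
  moreover have "\<bar>Re (\<zeta> r)\<bar> \<le> sqrt ((Re (\<zeta> r))\<^sup>2 + e\<^sup>2)" by simp
  ultimately show "\<bar>Re (\<zeta> r)\<bar> \<le> M * r + e" by linarith
qed

text \<open>The derivative of \<open>(Im \<zeta>)\<^sup>2\<close> is 4 times
  \<open>(Im \<zeta>)\<^sup>2 / (norm \<zeta>)\<^sup>2\<close>, hence at most 4.\<close>

lemma reverse_flow_Im_upper: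
  assumes rf: "reverse_flow w t y \<zeta>" and y: "0 < y" and r: "r \<in> {0..t}"
  shows "(Im (\<zeta> r))\<^sup>2 \<le> y\<^sup>2 + 4 * r"
proof -
  define f where "f s = 4 * s - (Im (\<zeta> s))\<^sup>2" for s
  have "f 0 \<le> f r"
  proof (rule deriv_nonneg_imp_le_within[of 0 t f
      "\<lambda>s. 4 - 2 * Im (\<zeta> s) * (2 * Im (\<zeta> s) / (norm (\<zeta> s))\<^sup>2)"])
    fix s assume s: "s \<in> {0..t}"
    show "(f has_real_derivative 4 - 2 * Im (\<zeta> s) * (2 * Im (\<zeta> s) / (norm (\<zeta> s))\<^sup>2)) (at s within {0..t})"
    proof -
      have "((\<lambda>s. 4 * s - (g s)\<^sup>2) has_real_derivative 4 - 2 * g s * d) (at s within A)"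
        if "(g has_real_derivative d) (at s within A)" for g d A
        by (auto intro!: derivative_eq_intros that)
      from this[OF reverse_flow_Im_deriv[OF rf s]] show ?thesis unfolding f_def .
    qed
    have "0 < (norm (\<zeta> s))\<^sup>2" using reverse_flow_Im_ge[OF rf s] y by auto
    then show "0 \<le> 4 - 2 * Im (\<zeta> s) * (2 * Im (\<zeta> s) / (norm (\<zeta> s))\<^sup>2)"
      by (simp add: field_simps cmod_power2) (simp add: power2_eq_square)
  qed (use r in auto)
  then show ?thesis using rf by (simp add: f_def reverse_flow_def)
qed

text \<open>The real part of \<open>\<zeta>\<^sup>2\<close> has derivative
  \<open>2 w Re \<zeta> - 4\<close>, at most \<open>2 M\<^sup>2 s - 4\<close> by the bound on
  \<open>Re \<zeta>\<close>. Integrating bounds it from above, and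
  \<open>(Im \<zeta>)\<^sup>2\<close> is at least its negative.\<close>

lemma reverse_flow_Im_lower:
  assumes rf: "reverse_flow w t y \<zeta>" and y: "0 < y"
    and w: "\<And>r. r \<in> {0..t} \<Longrightarrow> \<bar>w r\<bar> \<le> M" and r: "r \<in> {0..t}"
  shows "y\<^sup>2 + 4 * r - M\<^sup>2 * r\<^sup>2 \<le> (Im (\<zeta> r))\<^sup>2"
proof -
  define f where "f s = M\<^sup>2 * s\<^sup>2 - 4 * s - Re ((\<zeta> s)\<^sup>2)" for s
  have "f 0 \<le> f r"
  proof (rule deriv_nonneg_imp_le_within[of 0 t f "\<lambda>s. 2 * M\<^sup>2 * s - 2 * w s * Re (\<zeta> s)"])
    fix s assume s: "s \<in> {0..t}"
    have "((\<lambda>r. Re ((\<zeta> r)\<^sup>2)) has_real_derivative 2 * w s * Re (\<zeta> s) - 4) (at s within {0..t})"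
      using bounded_linear.has_vector_derivative[OF bounded_linear_Re reverse_flow_square_deriv[OF rf y s]]
      by (simp add: has_real_derivative_iff_has_vector_derivative)
    moreover have "((\<lambda>s. M\<^sup>2 * s\<^sup>2 - 4 * s - g s) has_real_derivative 2 * M\<^sup>2 * s - (d + 4)) (at s within A)"
      if "(g has_real_derivative d) (at s within A)" for g d A
      by (auto intro!: derivative_eq_intros that)
    ultimately show "(f has_real_derivative 2 * M\<^sup>2 * s - 2 * w s * Re (\<zeta> s)) (at s within {0..t})"
      unfolding f_def by fastforce
    have "w s * Re (\<zeta> s) \<le> \<bar>w s\<bar> * \<bar>Re (\<zeta> s)\<bar>" by (simp add: abs_mult[symmetric])
    also have "\<dots> \<le> M * (M * s)"
      using w[OF s] reverse_flow_Re_bound[OF rf y w s] by (intro mult_mono) auto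
    finally show "0 \<le> 2 * M\<^sup>2 * s - 2 * w s * Re (\<zeta> s)"
      by (simp add: power2_eq_square)
  qed (use r in auto)
  then have "Re ((\<zeta> r)\<^sup>2) \<le> M\<^sup>2 * r\<^sup>2 - 4 * r - y\<^sup>2"
    using rf by (simp add: f_def reverse_flow_def power2_eq_square)
  moreover have "Re ((\<zeta> r)\<^sup>2) = (Re (\<zeta> r))\<^sup>2 - (Im (\<zeta> r))\<^sup>2" by (simp add: power2_eq_square)
  ultimately show ?thesis using zero_le_power2[of "Re (\<zeta> r)"] by linarith
qed

text \<open>The product \<open>2 Re \<zeta> Im \<zeta>\<close> is the imaginary part of
  \<open>\<zeta>\<^sup>2\<close>, with derivative \<open>2 w Im \<zeta>\<close>. To leading order
  \<open>w\<close> is \<open>v\<close> and \<open>Im \<zeta>\<close> is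
  \<open>R r = sqrt (y\<^sup>2 + 4 r)\<close>, and \<open>2 v R\<close> integrates to
  \<open>v R ^ 3 / 3\<close> because \<open>R' = 2 / R\<close>.\<close>

lemma reverse_flow_Re_Im_estimate:
  assumes rf: "reverse_flow w t y \<zeta>" and y: "0 < y" and t: "0 \<le> t"
    and w: "\<And>r. r \<in> {0..t} \<Longrightarrow> \<bar>w r\<bar> \<le> M"
    and wv: "\<And>r. r \<in> {0..t} \<Longrightarrow> \<bar>w r - v\<bar> \<le> \<delta>" and v: "\<bar>v\<bar> \<le> M"
  shows "\<bar>2 * Re (\<zeta> t) * Im (\<zeta> t) - v * ((sqrt (y\<^sup>2 + 4 * t)) ^ 3 - y ^ 3) / 3\<bar>
    \<le> (2 * \<delta> + M ^ 3 * t / 2) * ((sqrt (y\<^sup>2 + 4 * t)) ^ 3 - y ^ 3) / 6"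
proof -
  define R where "R r = sqrt (y\<^sup>2 + 4 * r)" for r
  \<comment> \<open>The relative error of the derivative: \<open>2 \<delta>\<close> comes from
    replacing \<open>w\<close> by \<open>v\<close>, and \<open>M ^ 3 t / 2\<close> from replacing
    \<open>Im \<zeta>\<close> by \<open>R\<close>.\<close>
  define c where "c = 2 * \<delta> + M ^ 3 * t / 2"
  have M: "0 \<le> M" using v by linarith
  have R2: "(R r)\<^sup>2 = y\<^sup>2 + 4 * r" if "r \<in> {0..t}" for r
    using that by (simp add: R_def)
  have Rpos: "0 < R r" if "r \<in> {0..t}" for r
    using that y by (simp add: R_def add_pos_nonneg)
  have R_deriv: "((\<lambda>r. R r ^ 3) has_real_derivative 6 * R r) (at r within {0..t})"
    if "r \<in> {0..t}" for r
  proof -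
    have "(R has_real_derivative 2 / R r) (at r within {0..t})"
      unfolding R_def using Rpos[OF that]
      by (auto intro!: derivative_eq_intros simp: R_def field_simps)
    from DERIV_power[OF this, of 3] show ?thesis
      using Rpos[OF that] by (simp add: power2_eq_square field_simps)
  qed
  have key: "\<bar>2 * w r * Im (\<zeta> r) - 2 * v * R r\<bar> \<le> c * R r" if r: "r \<in> {0..t}" for r
  proof -
    let ?Y = "Im (\<zeta> r)"
    have Y: "0 < ?Y" using reverse_flow_Im_ge[OF rf r] y by linarith
    have YR: "?Y \<le> R r"
      using reverse_flow_Im_upper[OF rf y r] by (simp add: R_def real_le_rsqrt)
    \<comment> \<open>Passes from a bound on the difference of squares to one on
      \<open>R - Im \<zeta>\<close>. Below, one factor \<open>r\<close> is traded for
      \<open>R\<^sup>2 / 4\<close>, so that after cancelling \<open>R\<close> the error is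
      proportional to \<open>R\<close>.\<close>
    have "(R r - ?Y) * R r \<le> (R r)\<^sup>2 - ?Y\<^sup>2"
      using YR Y by (simp add: power2_eq_square algebra_simps mult_left_mono)
    also have "\<dots> \<le> M\<^sup>2 * r\<^sup>2"
      using reverse_flow_Im_lower[OF rf y w r] R2[OF r] by linarith
    also have "\<dots> = M\<^sup>2 * r * r" by (simp add: power2_eq_square)
    also have "\<dots> \<le> M\<^sup>2 * t * ((R r)\<^sup>2 / 4)"
      using r R2[OF r] by (intro mult_mono) auto
    finally have "(R r - ?Y) * R r \<le> (M\<^sup>2 * t * R r / 4) * R r"
      by (simp add: power2_eq_square)
    then have RY: "R r - ?Y \<le> M\<^sup>2 * t * R r / 4"
      using Rpos[OF r] by simp
    have "\<bar>2 * w r * ?Y - 2 * v * R r\<bar> = \<bar>2 * (w r - v) * ?Y - 2 * v * (R r - ?Y)\<bar>"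
      by (simp add: algebra_simps)
    also have "\<dots> \<le> 2 * (\<bar>w r - v\<bar> * ?Y) + 2 * (\<bar>v\<bar> * (R r - ?Y))"
    proof -
      have *: "\<bar>2 * a * ?Y - 2 * v * b\<bar> \<le> 2 * (\<bar>a\<bar> * ?Y) + 2 * (\<bar>v\<bar> * b)" if "0 \<le> b" for a b
        using Y that abs_triangle_ineq4[of "2 * a * ?Y" "2 * v * b"] by (simp add: abs_mult)
      show ?thesis by (rule *) (use YR in simp)
    qed
    also have "\<dots> \<le> 2 * (\<delta> * R r) + 2 * (M * (M\<^sup>2 * t * R r / 4))"
      using wv[OF r] v YR Y RY M
      by (intro add_mono mult_left_mono mult_mono) auto
    also have "\<dots> = c * R r" by (simp add: c_def algebra_simps power3_eq_cube power2_eq_square)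
    finally show ?thesis .
  qed
  have Im_deriv: "((\<lambda>r. Im ((\<zeta> r)\<^sup>2)) has_real_derivative 2 * w s * Im (\<zeta> s)) (at s within {0..t})"
    if "s \<in> {0..t}" for s
    using bounded_linear.has_vector_derivative[OF bounded_linear_Im reverse_flow_square_deriv[OF rf y that]]
    by (simp add: has_real_derivative_iff_has_vector_derivative)
  have Im0: "Im ((\<zeta> 0)\<^sup>2) = 0" using rf by (simp add: reverse_flow_def power2_eq_square)
  have R0: "R 0 = y" using y by (simp add: R_def)
  \<comment> \<open>The signs \<open>\<epsilon> = 1\<close> and \<open>\<epsilon> = -1\<close> give
    the two halves of the absolute value; \<open>c R ^ 3 / 6\<close> is an antiderivative of the
    error bound \<open>c R\<close>.\<close>
  define f where "f \<epsilon> r = c * R r ^ 3 / 6 + \<epsilon> * (Im ((\<zeta> r)\<^sup>2) - v * R r ^ 3 / 3)" for \<epsilon> r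
  have "f \<epsilon> 0 \<le> f \<epsilon> t" if "\<epsilon> = 1 \<or> \<epsilon> = -1" for \<epsilon>
  proof (rule deriv_nonneg_imp_le_within[of 0 t "f \<epsilon>"
      "\<lambda>r. c * R r + \<epsilon> * (2 * w r * Im (\<zeta> r) - 2 * v * R r)"])
    fix r assume r: "r \<in> {0..t}"
    show "(f \<epsilon> has_real_derivative c * R r + \<epsilon> * (2 * w r * Im (\<zeta> r) - 2 * v * R r)) (at r within {0..t})"
    proof -
      have "((\<lambda>r. c * p r / 6 + \<epsilon> * (g r - v * p r / 3)) has_real_derivative
          c * R r + \<epsilon> * (d - 2 * v * R r)) (at r within {0..t})"
        if "(p has_real_derivative 6 * R r) (at r within {0..t})"
          "(g has_real_derivative d) (at r within {0..t})" for p g d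
        by (auto intro!: derivative_eq_intros that simp: algebra_simps)
      from this[OF R_deriv[OF r] Im_deriv[OF r]] show ?thesis unfolding f_def .
    qed
    show "0 \<le> c * R r + \<epsilon> * (2 * w r * Im (\<zeta> r) - 2 * v * R r)"
      using key[OF r] that by (auto simp: abs_le_iff)
  qed (use t in auto)
  from this[of 1] this[of "-1"] have "f 1 0 \<le> f 1 t" "f (- 1) 0 \<le> f (- 1) t" by auto
  moreover have "Im ((\<zeta> t)\<^sup>2) = 2 * Re (\<zeta> t) * Im (\<zeta> t)" by (simp add: power2_eq_square)
  ultimately have "\<bar>2 * Re (\<zeta> t) * Im (\<zeta> t) - v * (R t ^ 3 - y ^ 3) / 3\<bar> \<le> c * (R t ^ 3 - y ^ 3) / 6"
    unfolding f_def Im0 R0 by (intro abs_leI) (simp_all add: field_simps)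
  then show ?thesis unfolding R_def c_def .
qed

text \<open>Gives the Cauchy property as \<open>y\<close> tends to 0 for fixed \<open>t\<close>. The
  difference \<open>D\<close> of the squares has derivative
  \<open>2 w (\<zeta>1 - \<zeta>2)\<close>, of norm at most \<open>M norm D / S\<close>. Since
  \<open>1 / S\<close> has a bounded integral however small the starting heights are, Gronwall's
  argument gives a uniform constant.\<close>

lemma reverse_flow_terminal_lipschitz:
  assumes rf: "reverse_flow w t y1 \<zeta>1" "reverse_flow w t y2 \<zeta>2"
    and y: "0 < y1" "y1 \<le> 1" "0 < y2" "y2 \<le> 1" and t: "0 < t"
    and w: "\<And>r. r \<in> {0..t} \<Longrightarrow> \<bar>w r\<bar> \<le> M" and Mt: "M\<^sup>2 * t \<le> 2"
  shows "norm (\<zeta>1 t - \<zeta>2 t) \<le> exp (M * sqrt (2 * t + 1)) / sqrt (2 * t) * \<bar>y1 - y2\<bar>"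
proof -
  define \<eta> where "\<eta> = min y1 y2"
  have \<eta>: "0 < \<eta>" "\<eta> \<le> y1" "\<eta> \<le> y2" "\<eta> \<le> 1" using y by (auto simp: \<eta>_def)
  have M: "0 \<le> M" using w[of 0] t by auto
  \<comment> \<open>A common lower bound for both imaginary parts:
    \<open>M\<^sup>2 t \<le> 2\<close> lets half of the growth \<open>4 r\<close> absorb the error
    \<open>M\<^sup>2 r\<^sup>2\<close>.\<close>
  define S where "S r = sqrt (2 * r + \<eta>\<^sup>2)" for r
  have Spos: "0 < S r" if "0 \<le> r" for r using that \<eta> by (simp add: S_def add_nonneg_pos)
  have Im_ge: "S r \<le> Im (\<zeta> r)" if rf: "reverse_flow w t y \<zeta>" and y: "\<eta> \<le> y" and r: "r \<in> {0..t}" for y \<zeta> r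
  proof -
    have y0: "0 < y" using y \<eta> by linarith
    have "M\<^sup>2 * r\<^sup>2 = M\<^sup>2 * r * r" by (simp add: power2_eq_square)
    also have "\<dots> \<le> M\<^sup>2 * t * r" using r by (intro mult_mono) auto
    also have "\<dots> \<le> 2 * r" using Mt r by (intro mult_right_mono) auto
    finally have "2 * r + y\<^sup>2 \<le> (Im (\<zeta> r))\<^sup>2"
      using reverse_flow_Im_lower[OF rf y0 w r] by linarith
    moreover have "\<eta>\<^sup>2 \<le> y\<^sup>2" using y \<eta> by (intro power_mono) auto
    moreover have "0 \<le> Im (\<zeta> r)" using reverse_flow_Im_ge[OF rf r] y0 by linarith
    ultimately show ?thesis unfolding S_def by (intro real_le_lsqrt) auto
  qed
  have sum_ge: "2 * S r \<le> norm (\<zeta>1 r + \<zeta>2 r)" if "r \<in> {0..t}" for r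
    using Im_ge[OF rf(1) \<eta>(2) that] Im_ge[OF rf(2) \<eta>(3) that] abs_Im_le_cmod[of "\<zeta>1 r + \<zeta>2 r"]
    by simp
  define D where "D r = (\<zeta>1 r)\<^sup>2 - (\<zeta>2 r)\<^sup>2" for r
  have D_factor: "D r = (\<zeta>1 r - \<zeta>2 r) * (\<zeta>1 r + \<zeta>2 r)" for r
    by (simp add: D_def power2_eq_square algebra_simps)
  have diff_le: "2 * S r * norm (\<zeta>1 r - \<zeta>2 r) \<le> norm (D r)" if "r \<in> {0..t}" for r
    using mult_right_mono[OF sum_ge[OF that], of "norm (\<zeta>1 r - \<zeta>2 r)"]
    by (simp add: D_factor norm_mult mult_ac)
  have D_deriv: "(D has_vector_derivative 2 * of_real (w r) * (\<zeta>1 r - \<zeta>2 r)) (at r within {0..t})"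
    if "r \<in> {0..t}" for r
    unfolding D_def
    using has_vector_derivative_diff[OF reverse_flow_square_deriv[OF rf(1) y(1) that]
        reverse_flow_square_deriv[OF rf(2) y(3) that]]
    by (simp add: algebra_simps)
  define N where "N r = (norm (D r))\<^sup>2" for r
  have N_deriv: "(N has_real_derivative 2 * (D r \<bullet> (2 * of_real (w r) * (\<zeta>1 r - \<zeta>2 r)))) (at r within {0..t})"
    if "r \<in> {0..t}" for r
  proof -
    have "((\<lambda>r. D r \<bullet> D r) has_derivative (\<lambda>h. D r \<bullet> (h *\<^sub>R (2 * of_real (w r) * (\<zeta>1 r - \<zeta>2 r)))
        + (h *\<^sub>R (2 * of_real (w r) * (\<zeta>1 r - \<zeta>2 r))) \<bullet> D r)) (at r within {0..t})"
      by (rule has_derivative_inner; rule D_deriv[OF that, unfolded has_vector_derivative_def])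
    then show ?thesis
      unfolding N_def power2_norm_eq_inner has_field_derivative_def
      by (rule has_derivative_eq_rhs) (auto simp: inner_commute algebra_simps)
  qed
  \<comment> \<open>Since \<open>S' = 1 / S\<close>, the exponent \<open>2 M S\<close> is an
    antiderivative of the Gronwall rate \<open>2 M / S\<close> of \<open>N\<close>.\<close>
  define f where "f r = - (N r * exp (- 2 * M * S r))" for r
  have S_deriv: "(S has_real_derivative 1 / S r) (at r within {0..t})" if "r \<in> {0..t}" for r
    unfolding S_def using Spos[of r] that
    by (auto intro!: derivative_eq_intros simp: S_def field_simps)
  have "f 0 \<le> f t"
  proof (rule deriv_nonneg_imp_le_within[of 0 t f
      "\<lambda>r. exp (- 2 * M * S r) * (N r * (2 * M / S r) - 2 * (D r \<bullet> (2 * of_real (w r) * (\<zeta>1 r - \<zeta>2 r))))"])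
    fix r assume r: "r \<in> {0..t}"
    show "(f has_real_derivative exp (- 2 * M * S r) *
        (N r * (2 * M / S r) - 2 * (D r \<bullet> (2 * of_real (w r) * (\<zeta>1 r - \<zeta>2 r))))) (at r within {0..t})"
      unfolding f_def
      by (auto intro!: derivative_eq_intros N_deriv[OF r] S_deriv[OF r] simp: algebra_simps)
    have "D r \<bullet> (2 * of_real (w r) * (\<zeta>1 r - \<zeta>2 r)) \<le> norm (D r) * norm (2 * of_real (w r) * (\<zeta>1 r - \<zeta>2 r))"
      by (rule norm_cauchy_schwarz)
    also have "\<dots> = norm (D r) * (2 * \<bar>w r\<bar> * norm (\<zeta>1 r - \<zeta>2 r))" by (simp add: norm_mult)
    also have "\<dots> \<le> norm (D r) * (2 * M * (norm (D r) / (2 * S r)))"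
      using w[OF r] M diff_le[OF r] Spos[of r] r
      by (intro mult_left_mono mult_mono) (auto simp: field_simps)
    also have "\<dots> = N r * (M / S r)" by (simp add: N_def power2_eq_square)
    finally have le: "D r \<bullet> (2 * of_real (w r) * (\<zeta>1 r - \<zeta>2 r)) \<le> N r * (M / S r)" .
    have "0 \<le> N r * (2 * M / S r) - 2 * d" if "d \<le> N r * (M / S r)" for d
    proof -
      have "2 * d \<le> 2 * (N r * (M / S r))" using that by linarith
      also have "\<dots> = N r * (2 * M / S r)" by simp
      finally show ?thesis by simp
    qed
    from this[OF le]
    show "0 \<le> exp (- 2 * M * S r) * (N r * (2 * M / S r) - 2 * (D r \<bullet> (2 * of_real (w r) * (\<zeta>1 r - \<zeta>2 r))))"
      by (intro mult_nonneg_nonneg) auto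
  qed (use t in auto)
  then have N_le: "N t * exp (- 2 * M * S t) \<le> N 0 * exp (- 2 * M * S 0)" by (simp add: f_def)
  \<comment> \<open>Here \<open>\<eta> \<le> 1\<close> removes the dependence on the starting
    heights from the constant.\<close>
  have "S t \<le> sqrt (2 * t + 1)"
    unfolding S_def using \<eta> by (intro real_sqrt_le_mono add_left_mono) (simp add: power_le_one)
  then have St: "M * S t \<le> M * sqrt (2 * t + 1)" using M by (rule mult_left_mono)
  have "N t \<le> N 0 * exp (2 * M * S t - 2 * M * S 0)"
    using N_le by (simp add: exp_diff exp_minus field_simps)
  also have "\<dots> \<le> N 0 * exp (2 * M * sqrt (2 * t + 1))"
    using St M Spos[of 0] by (intro mult_left_mono) (auto simp: N_def intro: order_trans[of _ "2 * M * S t"])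
  also have "\<dots> = (norm (D 0) * exp (M * sqrt (2 * t + 1)))\<^sup>2"
    by (simp add: N_def power_mult_distrib power2_eq_square[of "exp _"] exp_add[symmetric])
  finally have Dt: "norm (D t) \<le> norm (D 0) * exp (M * sqrt (2 * t + 1))"
    unfolding N_def by (rule power2_le_imp_le) simp
  have "D 0 = of_real (y2\<^sup>2 - y1\<^sup>2)"
    using rf by (simp add: D_def reverse_flow_def complex_eq_iff power2_eq_square)
  then have "norm (D 0) = \<bar>y2\<^sup>2 - y1\<^sup>2\<bar>" by (simp only: norm_of_real)
  also have "\<dots> = (y1 + y2) * \<bar>y1 - y2\<bar>"
  proof -
    have "y2\<^sup>2 - y1\<^sup>2 = (y1 + y2) * (y2 - y1)" by (simp add: power2_eq_square algebra_simps)
    then show ?thesis using y by (simp add: abs_mult abs_minus_commute)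
  qed
  also have "\<dots> \<le> 2 * \<bar>y1 - y2\<bar>" using y by (intro mult_right_mono) auto
  finally have D0: "norm (D 0) \<le> 2 * \<bar>y1 - y2\<bar>" .
  have "sqrt (2 * t) \<le> S t" by (simp add: S_def)
  then have "2 * sqrt (2 * t) * norm (\<zeta>1 t - \<zeta>2 t) \<le> 2 * S t * norm (\<zeta>1 t - \<zeta>2 t)"
    by (intro mult_right_mono) auto
  also have "\<dots> \<le> norm (D t)" using diff_le t by simp
  also have "\<dots> \<le> 2 * \<bar>y1 - y2\<bar> * exp (M * sqrt (2 * t + 1))"
    by (rule order_trans[OF Dt mult_right_mono[OF D0 exp_ge_zero]])
  finally show ?thesis using t by (simp add: field_simps)
qed

subsection \<open>The trace near its starting point\<close>

lemma at_0_within_Ioc_1: "at (0::real) within {0<..1} = at_right 0"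
  by (rule at_within_nhd[of _ "{..<1}"]) auto

text \<open>For each time the inverse map is Lipschitz in the height \<open>y\<close> on
  \<open>{0<..1}\<close>, hence uniformly continuous, and so has a limit at 0.\<close>

lemma loewner_curve_exists:
  assumes W: "\<And>s. s \<in> {0..T} \<Longrightarrow> (W has_vector_derivative W' s) (at s within {0..T})"
    and M: "\<And>s. s \<in> {0..T} \<Longrightarrow> \<bar>W' s\<bar> \<le> M" and T: "M\<^sup>2 * T \<le> 2"
  shows "\<exists>\<gamma>. loewner_curve W T \<gamma>"
proof -
  have "\<exists>l. ((\<lambda>y. inv_into (loewner_dom W t) (loewner_map W t) (Complex (W t) y)) \<longlongrightarrow> l) (at_right 0)"
    if t: "t \<in> {0..T}" for t
  proof -
    define f where "f y = inv_into (loewner_dom W t) (loewner_map W t) (Complex (W t) y)" for y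
    have W_t: "(W has_vector_derivative W' s) (at s within {0..t})" if "s \<in> {0..t}" for s
      by (rule has_vector_derivative_within_subset[OF W]) (use that t in auto)
    have flow: "\<exists>\<zeta>. reverse_flow (\<lambda>r. W' (t - r)) t y \<zeta> \<and> f y = of_real (W 0) + \<zeta> t" if "0 < y" for y
      using inv_loewner_map_reverse_flow[of t W W' y] W_t that t unfolding f_def by auto
    have "M\<^sup>2 * t \<le> M\<^sup>2 * T" using t by (intro mult_left_mono) auto
    then have Mt: "M\<^sup>2 * t \<le> 2" using T by linarith
    have "\<exists>C\<ge>0. \<forall>y1\<in>{0<..1}. \<forall>y2\<in>{0<..1}. dist (f y1) (f y2) \<le> C * dist y1 y2"
    \<comment> \<open>The Lipschitz constant contains \<open>1 / sqrt (2 t)\<close>; at time 0 the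
      inverse map is the identity instead.\<close>
    proof (cases "t = 0")
      case True
      have "f y = Complex (W 0) y" if "0 < y" for y
        using flow[OF that] True by (auto simp: reverse_flow_def complex_eq_iff)
      then show ?thesis
        by (intro exI[of _ 1]) (auto simp: dist_complex_def dist_real_def cmod_def)
    next
      case False
      define C where "C = exp (M * sqrt (2 * t + 1)) / sqrt (2 * t)"
      have "dist (f y1) (f y2) \<le> C * dist y1 y2" if y: "y1 \<in> {0<..1}" "y2 \<in> {0<..1}" for y1 y2
      proof -
        obtain \<zeta>1 \<zeta>2 where \<zeta>: "reverse_flow (\<lambda>r. W' (t - r)) t y1 \<zeta>1" "f y1 = of_real (W 0) + \<zeta>1 t"
          "reverse_flow (\<lambda>r. W' (t - r)) t y2 \<zeta>2" "f y2 = of_real (W 0) + \<zeta>2 t"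
          using flow[of y1] flow[of y2] y by auto
        have "norm (\<zeta>1 t - \<zeta>2 t) \<le> C * \<bar>y1 - y2\<bar>"
          unfolding C_def
          by (rule reverse_flow_terminal_lipschitz[OF \<zeta>(1,3)]) (use y t False M Mt in auto)
        then show ?thesis by (simp add: \<zeta> dist_norm)
      qed
      moreover have "0 \<le> C" using t by (simp add: C_def)
      ultimately show ?thesis by blast
    qed
    then obtain C where "C-lipschitz_on {0<..1} f" unfolding lipschitz_on_def by blast
    then have "uniformly_continuous_on {0<..1} f" by (rule lipschitz_on_uniformly_continuous)
    moreover have "0 \<in> closure {0<..(1::real)}" by simp
    ultimately obtain l where "(f \<longlongrightarrow> l) (at 0 within {0<..1})"
      by (rule uniformly_continuous_on_extension_at_closure)
    then show ?thesis unfolding f_def at_0_within_Ioc_1 by blast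
  qed
  then show ?thesis unfolding loewner_curve_def by metis
qed

text \<open>The reverse flow estimates are closed conditions and survive the limit \<open>y\<close>
  to 0, in which \<open>sqrt (y\<^sup>2 + 4 t) ^ 3 - y ^ 3\<close> becomes
  \<open>(2 sqrt t) ^ 3\<close>.\<close>

lemma loewner_curve_estimates:
  assumes W: "\<And>s. s \<in> {0..T} \<Longrightarrow> (W has_vector_derivative W' s) (at s within {0..T})"
    and \<gamma>: "loewner_curve W T \<gamma>" and t: "t \<in> {0..T}"
    and M: "\<And>s. s \<in> {0..t} \<Longrightarrow> \<bar>W' s\<bar> \<le> M"
    and \<delta>: "\<And>s. s \<in> {0..t} \<Longrightarrow> \<bar>W' s - v\<bar> \<le> \<delta>" and v: "\<bar>v\<bar> \<le> M"
  shows "\<bar>2 * (Re (\<gamma> t) - W 0) * Im (\<gamma> t) - v * (2 * sqrt t) ^ 3 / 3\<bar>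
      \<le> (2 * \<delta> + M ^ 3 * t / 2) * (2 * sqrt t) ^ 3 / 6" (is ?A)
    and "0 \<le> Im (\<gamma> t)" (is ?B) and "(Im (\<gamma> t))\<^sup>2 \<le> 4 * t" (is ?C)
    and "4 * t - M\<^sup>2 * t\<^sup>2 \<le> (Im (\<gamma> t))\<^sup>2" (is ?D)
proof -
  define f where "f y = inv_into (loewner_dom W t) (loewner_map W t) (Complex (W t) y)" for y
  have f_lim: "(f \<longlongrightarrow> \<gamma> t) (at_right 0)" using \<gamma> t by (simp add: f_def[abs_def] loewner_curve_def)
  note lims = tendsto_Re[OF f_lim] tendsto_Im[OF f_lim]
  have W_t: "(W has_vector_derivative W' s) (at s within {0..t})" if "s \<in> {0..t}" for s
    by (rule has_vector_derivative_within_subset[OF W]) (use that t in auto)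
  have id: "((\<lambda>y. y) \<longlongrightarrow> (0::real)) (at_right 0)" by (rule tendsto_ident_at)
  have bounds: "\<bar>2 * (Re (f y) - W 0) * Im (f y) - v * ((sqrt (y\<^sup>2 + 4 * t)) ^ 3 - y ^ 3) / 3\<bar>
      \<le> (2 * \<delta> + M ^ 3 * t / 2) * ((sqrt (y\<^sup>2 + 4 * t)) ^ 3 - y ^ 3) / 6 \<and>
      0 \<le> Im (f y) \<and> (Im (f y))\<^sup>2 \<le> y\<^sup>2 + 4 * t \<and> y\<^sup>2 + 4 * t - M\<^sup>2 * t\<^sup>2 \<le> (Im (f y))\<^sup>2"
    if y: "0 < y" for y
  proof -
    obtain \<zeta> where \<zeta>: "reverse_flow (\<lambda>r. W' (t - r)) t y \<zeta>" "f y = of_real (W 0) + \<zeta> t"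
      using inv_loewner_map_reverse_flow[of t W W' y] W_t y t unfolding f_def by auto
    have t': "0 \<le> t" "t \<in> {0..t}" using t by auto
    have M': "\<bar>W' (t - r)\<bar> \<le> M" and \<delta>': "\<bar>W' (t - r) - v\<bar> \<le> \<delta>" if "r \<in> {0..t}" for r
      using M[of "t - r"] \<delta>[of "t - r"] that by auto
    show ?thesis
      using reverse_flow_Re_Im_estimate[OF \<zeta>(1) y t'(1) M' \<delta>' v] reverse_flow_Im_ge[OF \<zeta>(1) t'(2)] y
        reverse_flow_Im_upper[OF \<zeta>(1) y t'(2)] reverse_flow_Im_lower[OF \<zeta>(1) y M' t'(2)]
      by (simp add: \<zeta>(2))
  qed
  have ev: "eventually (\<lambda>y::real. 0 < y) (at_right 0)" by (rule eventually_at_right_less)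
  define S where "S y = (sqrt (y\<^sup>2 + 4 * t)) ^ 3 - y ^ 3" for y
  have "(S \<longlongrightarrow> (sqrt (0\<^sup>2 + 4 * t)) ^ 3 - 0 ^ 3) (at_right 0)"
    unfolding S_def by (intro tendsto_intros id)
  then have S: "(S \<longlongrightarrow> (2 * sqrt t) ^ 3) (at_right 0)" by (simp add: real_sqrt_mult)
  have Y2: "((\<lambda>y. (Im (f y))\<^sup>2) \<longlongrightarrow> (Im (\<gamma> t))\<^sup>2) (at_right 0)"
    by (intro tendsto_intros lims)
  have L1: "((\<lambda>y. \<bar>2 * (Re (f y) - W 0) * Im (f y) - v * S y / 3\<bar>) \<longlongrightarrow>
      \<bar>2 * (Re (\<gamma> t) - W 0) * Im (\<gamma> t) - v * (2 * sqrt t) ^ 3 / 3\<bar>) (at_right 0)"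
    and L2: "((\<lambda>y. (2 * \<delta> + M ^ 3 * t / 2) * S y / 6) \<longlongrightarrow>
      (2 * \<delta> + M ^ 3 * t / 2) * (2 * sqrt t) ^ 3 / 6) (at_right 0)"
    by (intro tendsto_intros lims S; simp)+
  show ?A
    by (rule tendsto_le[OF trivial_limit_at_right_real L2 L1])
      (auto intro!: eventually_mono[OF ev] dest!: bounds simp: S_def)
  show ?B
    by (rule tendsto_lowerbound[OF lims(2)]) (auto intro: eventually_mono[OF ev] dest: bounds)
  have "((\<lambda>y. y\<^sup>2 + 4 * t) \<longlongrightarrow> 0\<^sup>2 + 4 * t) (at_right 0)"
    by (intro tendsto_intros id)
  then have "(Im (\<gamma> t))\<^sup>2 \<le> 0\<^sup>2 + 4 * t"
    by (rule tendsto_le[OF trivial_limit_at_right_real _ Y2])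
      (auto intro: eventually_mono[OF ev] dest: bounds)
  then show ?C by simp
  have "((\<lambda>y. y\<^sup>2 + 4 * t - M\<^sup>2 * t\<^sup>2) \<longlongrightarrow> 0\<^sup>2 + 4 * t - M\<^sup>2 * t\<^sup>2) (at_right 0)"
    by (intro tendsto_intros id)
  then have "0\<^sup>2 + 4 * t - M\<^sup>2 * t\<^sup>2 \<le> (Im (\<gamma> t))\<^sup>2"
    by (rule tendsto_le[OF trivial_limit_at_right_real Y2])
      (auto intro: eventually_mono[OF ev] dest: bounds)
  then show ?D by simp
qed

text \<open>With \<open>X = Re \<gamma> - W 0\<close> and \<open>Y = Im \<gamma>\<close>, the
  estimates show that \<open>A = 2 X Y / (2 sqrt t) ^ 3\<close> tends to \<open>W' 0 / 3\<close> and
  \<open>B = Y\<^sup>2 / (4 t)\<close> to 1. The powers of \<open>t\<close> cancel in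
  \<open>A / (2 B sqrt B) = X / Y\<^sup>2\<close>.\<close>

lemma loewner_curve_initial_speed:
  assumes T: "0 < T"
    and W: "\<And>s. s \<in> {0..T} \<Longrightarrow> (W has_vector_derivative W' s) (at s within {0..T})"
    and W': "continuous_on {0..T} W'" and \<gamma>: "loewner_curve W T \<gamma>"
  shows "((\<lambda>t. (Re (\<gamma> t) - W 0) / (Im (\<gamma> t))\<^sup>2) \<longlongrightarrow> W' 0 / 6) (at_right 0)"
proof -
  have "bounded (W' ` {0..T})"
    by (intro compact_imp_bounded compact_continuous_image W' compact_Icc)
  then obtain M where M: "\<And>s. s \<in> {0..T} \<Longrightarrow> \<bar>W' s\<bar> \<le> M"
    unfolding bounded_iff real_norm_def by (meson imageI)
  define v where "v = W' 0"
  have v: "\<bar>v\<bar> \<le> M" using M T by (simp add: v_def)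
  have W'v: "\<bar>W' s - v\<bar> \<le> 2 * M" if "s \<in> {0..T}" for s
    using M[OF that] v by linarith
  define X Y where "X t = Re (\<gamma> t) - W 0" and "Y t = Im (\<gamma> t)" for t
  have small: "eventually (\<lambda>t. t \<in> {0<..<T}) (at_right 0)"
    using T by (rule eventually_at_right_real)
  have id: "((\<lambda>t. t) \<longlongrightarrow> (0::real)) (at_right 0)" by (rule tendsto_ident_at)
  define A where "A t = 2 * X t * Y t / (2 * sqrt t) ^ 3" for t
  define B where "B t = (Y t)\<^sup>2 / (4 * t)" for t
  have A: "(A \<longlongrightarrow> v / 3) (at_right 0)"
  proof (rule tendstoI)
    fix e :: real assume e: "0 < e"
    have "continuous (at 0 within {0..T}) W'"
      using W' T by (auto simp: continuous_on_eq_continuous_within)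
    then obtain d where d: "0 < d" "\<And>s. s \<in> {0..T} \<Longrightarrow> \<bar>s\<bar> < d \<Longrightarrow> \<bar>W' s - v\<bar> < e"
      using e unfolding continuous_within_eps_delta v_def dist_real_def by (metis diff_zero)
    \<comment> \<open>Once this term is below \<open>e\<close>, the error
      \<open>(2 e + M ^ 3 t / 2) / 6\<close> is below \<open>e / 2\<close>.\<close>
    have "((\<lambda>t. M ^ 3 * t / 2) \<longlongrightarrow> M ^ 3 * 0 / 2) (at_right 0)"
      by (intro tendsto_intros id) simp
    then have "eventually (\<lambda>t. M ^ 3 * t / 2 < e) (at_right 0)"
      using e by (intro order_tendstoD(2)) auto
    moreover have "eventually (\<lambda>t. t < d) (at_right 0)"
      using id d(1) by (rule order_tendstoD(2))
    ultimately show "eventually (\<lambda>t. dist (A t) (v / 3) < e) (at_right 0)"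
      using small
    proof eventually_elim
      case (elim t)
      have "\<bar>W' s - v\<bar> \<le> e" if "s \<in> {0..t}" for s
        using d(2)[of s] that elim by auto
      then have est: "\<bar>2 * X t * Y t - v * (2 * sqrt t) ^ 3 / 3\<bar> \<le> (2 * e + M ^ 3 * t / 2) * (2 * sqrt t) ^ 3 / 6"
        unfolding X_def Y_def by (intro loewner_curve_estimates(1)[OF W \<gamma>] M v) (use elim in auto)
      have "\<bar>p / R - v / 3\<bar> \<le> c / 6" if "\<bar>p - v * R / 3\<bar> \<le> c * R / 6" "0 < R" for p R c :: real
      proof -
        have "p / R - v / 3 = (p - v * R / 3) / R" using that by (simp add: field_simps)
        then show ?thesis using that by (simp add: divide_le_eq)
      qed
      from this[OF est] have "\<bar>A t - v / 3\<bar> \<le> (2 * e + M ^ 3 * t / 2) / 6"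
        unfolding A_def using elim by simp
      then show ?case using elim e by (simp add: dist_real_def)
    qed
  qed
  have B: "(B \<longlongrightarrow> 1) (at_right 0)"
  proof (rule tendsto_sandwich[of "\<lambda>t. 1 - M\<^sup>2 * t / 4" B _ "\<lambda>_. 1"])
    have "((\<lambda>t. 1 - M\<^sup>2 * t / 4) \<longlongrightarrow> 1 - M\<^sup>2 * 0 / 4) (at_right 0)"
      by (intro tendsto_intros id) auto
    then show "((\<lambda>t. 1 - M\<^sup>2 * t / 4) \<longlongrightarrow> 1) (at_right 0)" by simp
    have "1 - M\<^sup>2 * t / 4 \<le> B t \<and> B t \<le> 1" if t: "t \<in> {0<..<T}" for t
    proof -
      have "(Y t)\<^sup>2 \<le> 4 * t" "4 * t - M\<^sup>2 * t\<^sup>2 \<le> (Y t)\<^sup>2"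
        unfolding Y_def
        by (rule loewner_curve_estimates[OF W \<gamma> _ M W'v v]; use t in simp)+
      then show ?thesis using t by (simp add: B_def field_simps power2_eq_square)
    qed
    then show "eventually (\<lambda>t. 1 - M\<^sup>2 * t / 4 \<le> B t) (at_right 0)" "eventually (\<lambda>t. B t \<le> 1) (at_right 0)"
      using small by (auto elim: eventually_mono)
  qed auto
  have "((\<lambda>t. A t / (2 * (B t * sqrt (B t)))) \<longlongrightarrow> v / 3 / (2 * (1 * sqrt 1))) (at_right 0)"
    by (intro tendsto_intros A B) auto
  moreover have "eventually (\<lambda>t. A t / (2 * (B t * sqrt (B t))) = X t / (Y t)\<^sup>2) (at_right 0)"
    using small
  proof eventually_elim
    case (elim t)
    have "0 \<le> Y t"
      unfolding Y_def
      by (rule loewner_curve_estimates(2)[OF W \<gamma> _ M W'v v]; use elim in simp)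
    moreover have B_eq: "B t = (Y t / (2 * sqrt t))\<^sup>2"
      using elim by (simp add: B_def power_divide power_mult_distrib)
    ultimately have sqrt_B: "sqrt (B t) = Y t / (2 * sqrt t)"
      using elim by (simp add: real_sqrt_unique)
    \<comment> \<open>For \<open>q = 0\<close> both sides are 0 because division by 0 gives
      0.\<close>
    have *: "2 * p * q / R ^ 3 / (2 * ((q / R)\<^sup>2 * (q / R))) = p / q\<^sup>2" if "0 < R" for p q R :: real
      using that by (cases "q = 0") (simp_all add: field_simps power2_eq_square power3_eq_cube)
    show ?case unfolding A_def sqrt_B unfolding B_eq by (rule *) (use elim in simp)
  qed
  ultimately have "((\<lambda>t. X t / (Y t)\<^sup>2) \<longlongrightarrow> v / 3 / (2 * (1 * sqrt 1))) (at_right 0)"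
    by (rule Lim_transform_eventually)
  then show ?thesis by (simp add: X_def Y_def v_def)
qed

subsection \<open>Affine covariance\<close>

lemma open_distinct_points: "open (distinct_points :: (real ^ 'm) set)"
proof -
  have "(distinct_points :: (real ^ 'm) set) = (\<Inter>(j, k)\<in>{(j, k). j \<noteq> k}. {x. x $ j \<noteq> x $ k})"
    by (auto simp: distinct_points_def)
  moreover have "open \<dots>"
    by (intro open_INT) (auto intro!: open_Collect_neq continuous_intros)
  ultimately show ?thesis by simp
qed

lemma C_k_on_1_inverse_difference:
  assumes jk: "j \<noteq> k"
  shows "C_k_on 1 distinct_points (\<lambda>x :: real ^ 'm. 2 / (x $ k - x $ j))"
proof -
  let ?f = "\<lambda>x :: real ^ 'm. 2 / (x $ k - x $ j)"
  have der: "(?f has_derivative (\<lambda>v. - 2 * (v $ k - v $ j) / (x $ k - x $ j)\<^sup>2)) (at x)"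
    if "x \<in> distinct_points" for x
  proof -
    have ne: "x $ k - x $ j \<noteq> 0" using that jk by (auto simp: distinct_points_def)
    have "((\<lambda>x. x $ k - x $ j) has_derivative (\<lambda>v. v $ k - v $ j)) (at x)"
      by (intro has_derivative_diff bounded_linear_imp_has_derivative bounded_linear_vec_nth)
    from has_derivative_divide'[OF has_derivative_const this ne] show ?thesis
      by (rule has_derivative_eq_rhs) (simp add: fun_eq_iff power2_eq_square)
  qed
  have "frechet_derivative ?f (at x) v = - 2 * (v $ k - v $ j) / (x $ k - x $ j)\<^sup>2"
    if "x \<in> distinct_points" for x v
    by (rule fun_cong[OF frechet_derivative_at[OF der[OF that], symmetric]])
  moreover have "continuous_on distinct_points (\<lambda>x :: real ^ 'm. - 2 * (v $ k - v $ j) / (x $ k - x $ j)\<^sup>2)" for v :: "real ^ 'm"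
    using jk by (intro continuous_intros) (auto simp: distinct_points_def)
  ultimately have "continuous_on distinct_points (\<lambda>x. frechet_derivative ?f (at x) v)" for v
    by (subst continuous_on_cong[OF refl]) auto
  moreover have "?f differentiable (at x)" if "x \<in> distinct_points" for x
    using der[OF that] by (rule differentiableI)
  ultimately show ?thesis by simp
qed

lemma C_k_on_subset: "C_k_on k S f \<Longrightarrow> T \<subseteq> S \<Longrightarrow> C_k_on k T f"
  by (induction k arbitrary: f) (auto intro: continuous_on_subset)

text \<open>All coordinates of the vector field are continuously differentiable on \<open>C\<close>,
  hence Lipschitz on a ball inside \<open>C\<close>. The separate function \<open>V'\<close> lets
  \<open>V\<close> borrow its regularity from a partial derivative with which it agrees on
  \<open>C\<close>.\<close>

lemma driving_solution_exists:
  fixes V :: "real ^ 'm \<Rightarrow> real"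
  assumes C: "open C" "C \<subseteq> distinct_points" "x0 \<in> C"
    and V': "C_k_on 1 C V'" and V: "\<And>x. x \<in> C \<Longrightarrow> V x = V' x"
  shows "\<exists>T>0. \<exists>x. driving_solution V j x0 T x"
proof -
  obtain r where r: "0 < r" "cball x0 r \<subseteq> C" using C open_contains_cball by blast
  define G :: "real ^ 'm \<Rightarrow> real ^ 'm"
    where "G x = (\<chi> k. if k = j then V x else 2 / (x $ k - x $ j))" for x
  have "\<exists>L\<ge>0. \<forall>x\<in>cball x0 r. \<forall>y\<in>cball x0 r. \<bar>G x $ k - G y $ k\<bar> \<le> L * norm (x - y)" for k
  proof (cases "k = j")
    case True
    have "V x = V' x" if "x \<in> cball x0 r" for x using V r that by auto
    with C_k_on_1_lipschitz_cball[OF V' r(2)] show ?thesis by (simp add: G_def True)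
  next
    case False
    then have "C_k_on 1 C (\<lambda>x :: real ^ 'm. 2 / (x $ k - x $ j))"
      using C_k_on_subset[OF C_k_on_1_inverse_difference C(2)] by metis
    from C_k_on_1_lipschitz_cball[OF this r(2)] show ?thesis by (simp add: G_def False)
  qed
  then obtain L where L: "\<And>k. 0 \<le> L k"
    "\<And>k x y. x \<in> cball x0 r \<Longrightarrow> y \<in> cball x0 r \<Longrightarrow> \<bar>G x $ k - G y $ k\<bar> \<le> L k * norm (x - y)"
    by metis
  obtain T x where x: "0 < T" "x 0 = x0" "\<And>t. t \<in> {0..T} \<Longrightarrow> x t \<in> cball x0 r"
    "\<And>t. t \<in> {0..T} \<Longrightarrow> (x has_vector_derivative G (x t)) (at t within {0..T})"
  proof (rule ode_local_solution[of r "sum L UNIV" x0 G])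
    show "0 \<le> sum L UNIV" using L by (intro sum_nonneg) auto
    fix x y assume xy: "x \<in> cball x0 r" "y \<in> cball x0 r"
    have "norm (G x - G y) \<le> (\<Sum>k\<in>UNIV. \<bar>G x $ k - G y $ k\<bar>)"
      using norm_le_l1_cart[of "G x - G y"] by simp
    also have "\<dots> \<le> (\<Sum>k\<in>UNIV. L k * norm (x - y))" by (intro sum_mono L xy)
    finally show "norm (G x - G y) \<le> sum L UNIV * norm (x - y)" by (simp add: sum_distrib_right)
  qed (use r in auto)
  have "driving_solution V j x0 T x"
    unfolding driving_solution_def
  proof (intro conjI ballI)
    fix t assume t: "t \<in> {0..T}"
    show "x t \<in> distinct_points" using x(3)[OF t] r(2) C(2) by (meson subsetD)
    show "(x has_vector_derivative (\<chi> k. if k = j then V (x t) else 2 / (x t $ k - x t $ j))) (at t within {0..T})"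
      using x(4)[OF t] by (simp only: G_def)
  qed (rule x(2))
  then show ?thesis using x(1) by blast
qed

lemma driving_solution_driving_function:
  assumes x: "driving_solution V j x0 T x" and V: "continuous_on distinct_points V"
  shows "\<And>t. t \<in> {0..T} \<Longrightarrow> ((\<lambda>t. x t $ j) has_vector_derivative V (x t)) (at t within {0..T})"
    and "continuous_on {0..T} (\<lambda>t. V (x t))"
proof -
  have der: "(x has_vector_derivative (\<chi> k. if k = j then V (x t) else 2 / (x t $ k - x t $ j))) (at t within {0..T})"
    if "t \<in> {0..T}" for t
    using x that by (simp add: driving_solution_def)
  show "((\<lambda>t. x t $ j) has_vector_derivative V (x t)) (at t within {0..T})" if "t \<in> {0..T}" for t
    using bounded_linear.has_vector_derivative[OF bounded_linear_vec_nth der[OF that], of j] by simp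
  have "continuous_on {0..T} x" by (rule continuous_on_vector_derivative) (rule der)
  then show "continuous_on {0..T} (\<lambda>t. V (x t))"
    by (rule continuous_on_compose2[OF V]) (use x in \<open>auto simp: driving_solution_def\<close>)
qed

lemma driving_solution_restrict:
  assumes "driving_solution V j x0 T x" "S \<le> T"
  shows "driving_solution V j x0 S x"
  unfolding driving_solution_def
proof (intro conjI ballI)
  fix t assume t: "t \<in> {0..S}"
  then have t': "t \<in> {0..T}" using assms(2) by auto
  show "x t \<in> distinct_points" using assms(1) t' by (simp add: driving_solution_def)
  show "(x has_vector_derivative (\<chi> k. if k = j then V (x t) else 2 / (x t $ k - x t $ j))) (at t within {0..S})"
    by (rule has_vector_derivative_within_subset[of _ _ _ "{0..T}"])
      (use assms t' in \<open>auto simp: driving_solution_def\<close>)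
qed (use assms in \<open>simp add: driving_solution_def\<close>)

section \<open>Initial speed of generated curves and its scaling\<close>

lemma generated_curve_initial_speed:
  assumes "generated_curve V j x0 T \<gamma>" "0 < T" and V: "continuous_on distinct_points V"
  shows "((\<lambda>t. (Re (\<gamma> t) - x0 $ j) / (Im (\<gamma> t))\<^sup>2) \<longlongrightarrow> V x0 / 6) (at_right 0)"
proof -
  obtain x where x: "driving_solution V j x0 T x" "loewner_curve (\<lambda>t. x t $ j) T \<gamma>"
    using assms by (auto simp: generated_curve_def)
  have "x 0 = x0" using x by (simp add: driving_solution_def)
  with loewner_curve_initial_speed[OF \<open>0 < T\<close> driving_solution_driving_function[OF x(1) V] x(2)]
  show ?thesis by simp
qed

lemma generated_curve_exists:
  assumes "\<exists>T>0. \<exists>x. driving_solution V j x0 T x" and V: "continuous_on distinct_points V"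
  shows "\<exists>T>0. \<exists>\<gamma>. generated_curve V j x0 T \<gamma>"
proof -
  obtain T x where T: "0 < T" and x: "driving_solution V j x0 T x" using assms by blast
  have "bounded ((\<lambda>t. V (x t)) ` {0..T})"
    by (intro compact_imp_bounded compact_continuous_image driving_solution_driving_function[OF x V] compact_Icc)
  then obtain M where M: "\<And>t. t \<in> {0..T} \<Longrightarrow> \<bar>V (x t)\<bar> \<le> M"
    unfolding bounded_iff real_norm_def by (meson imageI)
  \<comment> \<open>Shortens the lifetime so that \<open>M\<^sup>2 S \<le> 2\<close>, as the
    existence of the trace requires; adding 1 avoids a zero denominator.\<close>
  define S where "S = min T (2 / (M\<^sup>2 + 1))"
  have pos: "0 < M\<^sup>2 + 1" by (simp add: add_nonneg_pos)
  have S: "0 < S" "S \<le> T" using T pos by (auto simp: S_def)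
  have "M\<^sup>2 * S \<le> (M\<^sup>2 + 1) * (2 / (M\<^sup>2 + 1))"
    using S(1) by (intro mult_mono) (auto simp: S_def)
  also have "\<dots> = 2" using pos by (simp add: field_simps)
  finally have MS: "M\<^sup>2 * S \<le> 2" .
  have xS: "driving_solution V j x0 S x" by (rule driving_solution_restrict[OF x S(2)])
  have "\<exists>\<gamma>. loewner_curve (\<lambda>t. x t $ j) S \<gamma>"
    by (rule loewner_curve_exists[OF driving_solution_driving_function(1)[OF xS V] _ MS]) (use M S in auto)
  then show ?thesis using xS S unfolding generated_curve_def by blast
qed

text \<open>An increasing map onto \<open>{0..S}\<close> must send 0 to 0, so limits at time 0 from
  the right can be composed with the time change.\<close>

lemma time_change_filterlim:
  assumes \<sigma>: "time_change T S \<sigma>" and T: "0 < T"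
  shows "0 < S" and "filterlim \<sigma> (at_right 0) (at_right 0)"
proof -
  have img: "\<sigma> ` {0..T} = {0..S}" and mono: "strict_mono_on {0..T} \<sigma>" and cont: "continuous_on {0..T} \<sigma>"
    using \<sigma> by (auto simp: time_change_def)
  have "\<sigma> 0 \<in> {0..S}" using img T by auto
  then have "0 \<in> \<sigma> ` {0..T}" unfolding img by simp
  then obtain s where s: "s \<in> {0..T}" "\<sigma> s = 0" by auto
  have "s = 0"
  proof (rule ccontr)
    assume "s \<noteq> 0"
    then have "\<sigma> 0 < \<sigma> s" using s T by (intro strict_mono_onD[OF mono]) auto
    then show False using \<open>\<sigma> 0 \<in> {0..S}\<close> s by simp
  qed
  with s have \<sigma>0: "\<sigma> 0 = 0" by simp
  have pos: "0 < \<sigma> t" if "t \<in> {0<..T}" for t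
    using strict_mono_onD[OF mono, of 0 t] that \<sigma>0 by auto
  have "\<sigma> T \<in> {0..S}" using img T by auto
  then show "0 < S" using pos[of T] T by auto
  have "(\<sigma> \<longlongrightarrow> \<sigma> 0) (at 0 within {0..T})" using cont T by (auto simp: continuous_on_def)
  then have "(\<sigma> \<longlongrightarrow> 0) (at_right 0)" using T \<sigma>0 by (simp add: at_within_Icc_at_right)
  moreover have "eventually (\<lambda>t. \<sigma> t \<in> {0<..} \<and> \<sigma> t \<noteq> 0) (at_right 0)"
    using eventually_at_right_real[OF T] by eventually_elim (use pos in force)
  ultimately show "filterlim \<sigma> (at_right 0) (at_right 0)" unfolding filterlim_at by simp
qed

text \<open>Local existence supplies an actual curve to which invariance applies. The limit of
  \<open>(Re \<gamma> - x0 $ j) / (Im \<gamma>)\<^sup>2\<close> is then computed twice, from the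
  image curve and by scaling the original one.\<close>

lemma moebius_invariant_affine:
  fixes V :: "real ^ 'm \<Rightarrow> real"
  assumes inv: "moebius_invariant V j" and V: "continuous_on distinct_points V"
    and x0: "x0 \<in> distinct_points" and ex: "\<exists>T>0. \<exists>x. driving_solution V j x0 T x"
    and l: "0 < l"
  shows "V (\<chi> k. l * x0 $ k + b) = V x0 / l"
proof -
  obtain T \<gamma> where T: "0 < T" and \<gamma>: "generated_curve V j x0 T \<gamma>"
    using generated_curve_exists[OF ex V] by blast
  \<comment> \<open>The coefficients \<open>q, b / q, 0, 1 / q\<close> have determinant 1 and
    represent \<open>z \<mapsto> l z + b\<close>; no finite point is sent to infinity.\<close>
  define q where "q = sqrt l"
  have q: "0 < q" "q * q = l" using l by (auto simp: q_def)
  define y0 where "y0 = (\<chi> k. l * x0 $ k + b)"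
  have affine: "moebius q (b / q) 0 (1 / q) z = l * z + b" for z :: real
    using q by (simp add: moebius_def field_simps)
  have affine_complex: "moebius (of_real q) (of_real (b / q)) (of_real 0) (of_real (1 / q)) z
      = of_real l * z + of_real b" for z :: complex
    using q by (simp add: moebius_def field_simps flip: of_real_mult)
  have "\<exists>S \<sigma> \<gamma>'. time_change T S \<sigma> \<and>
      generated_curve V j (\<chi> k. moebius q (b / q) 0 (1 / q) (x0 $ k)) S \<gamma>' \<and>
      (\<forall>t\<in>{0..T}. moebius (of_real q) (of_real (b / q)) (of_real 0) (of_real (1 / q)) (\<gamma> t) = \<gamma>' (\<sigma> t))"
    by (rule moebius_invariant_def[THEN iffD1, OF inv, rule_format, OF x0]) (use T \<gamma> q in auto)
  then obtain S \<sigma> \<gamma>' where \<sigma>: "time_change T S \<sigma>" and \<gamma>': "generated_curve V j y0 S \<gamma>'"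
      and eq: "\<And>t. t \<in> {0..T} \<Longrightarrow> \<gamma>' (\<sigma> t) = of_real l * \<gamma> t + of_real b"
    unfolding affine affine_complex y0_def by metis
  note lim = generated_curve_initial_speed[OF \<gamma> T V]
  have "((\<lambda>t. (Re (\<gamma>' (\<sigma> t)) - y0 $ j) / (Im (\<gamma>' (\<sigma> t)))\<^sup>2) \<longlongrightarrow> V y0 / 6) (at_right 0)"
    by (rule filterlim_compose[OF generated_curve_initial_speed[OF \<gamma>' time_change_filterlim(1)[OF \<sigma> T] V]
          time_change_filterlim(2)[OF \<sigma> T]])
  moreover have "eventually (\<lambda>t. (Re (\<gamma>' (\<sigma> t)) - y0 $ j) / (Im (\<gamma>' (\<sigma> t)))\<^sup>2
      = (Re (\<gamma> t) - x0 $ j) / (Im (\<gamma> t))\<^sup>2 / l) (at_right 0)"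
    using eventually_at_right_real[OF T]
  proof eventually_elim
    case (elim t)
    then have "\<gamma>' (\<sigma> t) = of_real l * \<gamma> t + of_real b" by (intro eq) auto
    then have "(Re (\<gamma>' (\<sigma> t)) - y0 $ j) / (Im (\<gamma>' (\<sigma> t)))\<^sup>2 = l * (Re (\<gamma> t) - x0 $ j) / (l * Im (\<gamma> t))\<^sup>2"
      by (simp add: y0_def algebra_simps)
    also have "\<dots> = (Re (\<gamma> t) - x0 $ j) / (Im (\<gamma> t))\<^sup>2 / l"
      using l by (simp add: power2_eq_square)
    finally show ?case .
  qed
  ultimately have "((\<lambda>t. (Re (\<gamma> t) - x0 $ j) / (Im (\<gamma> t))\<^sup>2 / l) \<longlongrightarrow> V y0 / 6) (at_right 0)"
    by (rule Lim_transform_eventually)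
  moreover have "((\<lambda>t. (Re (\<gamma> t) - x0 $ j) / (Im (\<gamma> t))\<^sup>2 / l) \<longlongrightarrow> V x0 / 6 / l) (at_right 0)"
    using l by (intro tendsto_intros lim) auto
  ultimately have "V y0 / 6 = V x0 / 6 / l"
    by (rule tendsto_unique[OF trivial_limit_at_right_real])
  then show ?thesis by (simp add: y0_def)
qed

theorem theorem5p2:
  fixes n :: nat
    and \<U> :: "real ^ 'm \<Rightarrow> real"
    and U :: "'m \<Rightarrow> real ^ 'm \<Rightarrow> real"
    and h :: "'m \<Rightarrow> real \<Rightarrow> real"
  assumes "n \<ge> 1"
    and "CARD('m) = 2 * n"
    and "\<And>C. C \<in> components (distinct_points :: (real ^ 'm) set) \<Longrightarrow> smooth_on C \<U>"
    and "\<And>j x. x \<in> distinct_points \<Longrightarrow> U j x = partial j \<U> x"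
    and "\<And>j. smooth_on UNIV (h j)"
    and "\<And>j x. x \<in> distinct_points \<Longrightarrow>
           1 / 2 * (U j x)\<^sup>2 + (\<Sum>k\<in>UNIV - {j}. 2 / (x $ k - x $ j) * U k x)
             - (\<Sum>k\<in>UNIV - {j}. 6 / (x $ k - x $ j)\<^sup>2) = h j (x $ j)"
    and "\<And>j. moebius_invariant (U j) j"
  shows "\<forall>j s. h j s = 0"
proof (intro allI)
  fix j :: 'm and s :: real
  let ?D = "distinct_points :: (real ^ 'm) set"
  have C1: "C_k_on 1 C (partial i \<U>)" if C: "C \<in> components ?D" for C i
  proof -
    have "C_k_on 2 C \<U>" using assms(3)[OF C] by (simp add: smooth_on_def)
    then have "C_k_on 1 C (\<lambda>x. frechet_derivative \<U> (at x) (axis i 1))"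
      by (simp add: numeral_2_eq_2)
    then show ?thesis by (simp add: partial_def[abs_def])
  qed
  have comp: "\<exists>C\<in>components ?D. x \<in> C \<and> open C \<and> C \<subseteq> ?D" if "x \<in> ?D" for x
  proof (intro bexI conjI)
    show C: "connected_component_set ?D x \<in> components ?D" using that by (rule componentsI)
    show "x \<in> connected_component_set ?D x" using that by simp
    show "open (connected_component_set ?D x)" by (rule open_components[OF open_distinct_points C])
    show "connected_component_set ?D x \<subseteq> ?D" by (rule connected_component_subset)
  qed
  \<comment> \<open>Smoothness is given on each component separately; as components are open, it
    yields continuity at every point and hence on all of \<open>?D\<close>.\<close>
  have U_cont: "continuous_on ?D (U i)" for i
  proof -
    have "continuous_on ?D (partial i \<U>)"
    proof (rule continuous_at_imp_continuous_on, intro ballI)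
      fix x assume "x \<in> ?D"
      then obtain C where "C \<in> components ?D" "x \<in> C" using comp by blast
      then have "partial i \<U> differentiable (at x)" using C1 by auto
      then show "isCont (partial i \<U>) x" by (rule differentiable_imp_continuous_within)
    qed
    then show ?thesis by (simp add: assms(4) cong: continuous_on_cong)
  qed
  have solution: "\<exists>T>0. \<exists>x. driving_solution (U i) i x0 T x" if x0: "x0 \<in> ?D" for i x0
  proof -
    obtain C where C: "C \<in> components ?D" "x0 \<in> C" "open C" "C \<subseteq> ?D" using comp[OF x0] by blast
    show ?thesis
      by (rule driving_solution_exists[OF C(3,4,2) C1[OF C(1)]]) (use C assms(4) in auto)
  qed
  \<comment> \<open>An injective numbering of the indices gives a point with distinct coordinates
    whose \<open>j\<close>-th one is \<open>s\<close>.\<close>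
  obtain e :: "'m \<Rightarrow> nat" where e: "inj e" using finite_imp_inj_to_nat_seg[of "UNIV :: 'm set"] by auto
  define x where "x = (\<chi> k. s + (real (e k) - real (e j)))"
  \<comment> \<open>The dilation by 2 about \<open>s\<close> fixes the \<open>j\<close>-th
    coordinate, so \<open>h j\<close> is evaluated at \<open>s\<close> for both points.\<close>
  define y where "y = (\<chi> k. 2 * x $ k + - s)"
  have x: "x \<in> ?D" using e by (auto simp: distinct_points_def x_def inj_def)
  then have y: "y \<in> ?D" by (auto simp: distinct_points_def y_def)
  have xj: "x $ j = s" "y $ j = s" by (simp_all add: x_def y_def)
  have Uy: "U k y = U k x / 2" for k
    unfolding y_def by (rule moebius_invariant_affine[OF assms(7) U_cont x solution[OF x]]) simp
  have diff: "y $ k - y $ j = 2 * (x $ k - x $ j)" for k by (simp add: y_def)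
  have "h j s = 1 / 2 * (U j y)\<^sup>2 + (\<Sum>k\<in>UNIV - {j}. 2 / (y $ k - y $ j) * U k y)
      - (\<Sum>k\<in>UNIV - {j}. 6 / (y $ k - y $ j)\<^sup>2)"
    using assms(6)[OF y, of j] by (simp add: xj)
  also have "\<dots> = (1 / 2 * (U j x)\<^sup>2 + (\<Sum>k\<in>UNIV - {j}. 2 / (x $ k - x $ j) * U k x)
      - (\<Sum>k\<in>UNIV - {j}. 6 / (x $ k - x $ j)\<^sup>2)) / 4"
  proof -
    \<comment> \<open>Each of the three kinds of terms is homogeneous of degree -2 under the
      dilation, since the \<open>U k\<close> have degree -1.\<close>
    have "2 / (2 * d) * (u / 2) = 2 / d * u / 4" "6 / (2 * d)\<^sup>2 = 6 / d\<^sup>2 / 4"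
      "1 / 2 * (u / 2)\<^sup>2 = 1 / 2 * u\<^sup>2 / 4" for d u :: real
      by (simp_all add: power_mult_distrib power_divide)
    then show ?thesis
      unfolding Uy diff by (simp only: add_divide_distrib diff_divide_distrib sum_divide_distrib)
  qed
  also have "\<dots> = h j s / 4"
    using assms(6)[OF x, of j] by (simp add: xj)
  finally show "h j s = 0" by simp
qed

end
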